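(* Let $L$ be a countably infinite set and consider the edgeless cube $Q_L$. Every legal configuration accessible from $f_{\mathrm{solved}}$ can be solved in at most $\omega^2$ many moves: for each such configuration $f$ there is a basic sequence of length at most $\omega^2$ which, applied to $f$, has terminal configuration $f_{\mathrm{solved}}$.
   Context: Let $L$ be an infinite set, $-L=\{-r:r\in L\}$ a disjoint copy of $L$, and $0$ a new element; $L^\dagger=-L\cup\{0\}\cup L$ with $-(-r)=r$, $-0=0$. Adjoin $\pm\infty$ with $-(+\infty)=-\infty$ and set $\bar L^\dagger=L^\dagger\cup\{\pm\infty\}$. Points of $U=(\bar L^\dagger)^3$ have coordinates $x,y,z$. The edgeless cube $Q_L$ is the set of cells: points of $U$ with exactly one coordinate in $\{\pm\infty\}$. For $i\in\{x,y,z\}$, $\alpha\in\bar L^\dagger$, the quarter-turn twist $T_{i,\alpha}$ is the permutation of cells fixing every cell $p$ with $p_i\ne\alpha$ and acting on the others by $T_{x,\alpha}(\alpha,y,z)=(\alpha,-z,y)$, $T_{y,\alpha}(x,\alpha,z)=(z,\alpha,-x)$, $T_{z,\alpha}(x,y,\alpha)=(-y,x,\alpha)$ (so a face twist $T_{i,\pm\infty}$ moves only cells of that face). Basic twists are $T,T^2,T^3$ for quarter-turn twists $T$. A basic sequence is a sequence $\langle\sigma_\eta:\eta<\theta\rangle$ of basic twists of ordinal length $\theta$. A configuration is a map $f$ from cells to the six colors red, white, green, orange, yellow, blue together with a special value NaC; it is legal if it never takes value NaC. The solved configuration $f_{\mathrm{solved}}$ colors a cell red, blue, white, orange, green, yellow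 according as $x=+\infty$, $y=+\infty$, $z=+\infty$, $x=-\infty$, $y=-\infty$, $z=-\infty$. A twist $\sigma$ acts by $(\sigma f)(c)=f(\sigma^{-1}c)$. Applying $\langle\sigma_\eta:\eta<\theta\rangle$ to $f_0$ produces $f_{\eta+1}=\sigma_\eta f_\eta$, and for limit $\lambda\le\theta$, $f_\lambda(c)$ is the eventually constant value of $f_\eta(c)$ ($\eta<\lambda$) if it exists and NaC otherwise; $f_\theta$ is the terminal configuration. $f$ is accessible from $f_0$ if it is the terminal configuration of some basic sequence applied to $f_0$. *)

theory Defs
  imports "HOL-Library.Countable_Set"
begin

(* Coordinates: L^dagger = -L \<union> {0} \<union> L together with +inf and -inf.  The type 'l plays the role of L. *)
datatype 'l coord = Pos 'l | Neg 'l | Zero | PInf | NInf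

fun neg :: "'l coord \<Rightarrow> 'l coord" where
  "neg (Pos r) = Neg r" | "neg (Neg r) = Pos r" | "neg Zero = Zero"
| "neg PInf = NInf" | "neg NInf = PInf"

type_synonym 'l point = "'l coord \<times> 'l coord \<times> 'l coord"

definition is_inf :: "'l coord \<Rightarrow> bool" where
  "is_inf a \<longleftrightarrow> a = PInf \<or> a = NInf"

definition is_cell :: "'l point \<Rightarrow> bool" where
  "is_cell p = (case p of (x, y, z) \<Rightarrow>
     (is_inf x \<and> \<not> is_inf y \<and> \<not> is_inf z) \<or>
     (\<not> is_inf x \<and> is_inf y \<and> \<not> is_inf z) \<or>
     (\<not> is_inf x \<and> \<not> is_inf y \<and> is_inf z))"

datatype axis = AX | AY | AZ

(* quarter-turn twist T_{i,alpha}; defined on all of U, it preserves the set of cells *)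
fun quarter :: "axis \<Rightarrow> 'l coord \<Rightarrow> 'l point \<Rightarrow> 'l point" where
  "quarter AX \<alpha> (x, y, z) = (if x = \<alpha> then (x, neg z, y) else (x, y, z))"
| "quarter AY \<alpha> (x, y, z) = (if y = \<alpha> then (z, y, neg x) else (x, y, z))"
| "quarter AZ \<alpha> (x, y, z) = (if z = \<alpha> then (neg y, x, z) else (x, y, z))"

type_synonym 'l twist = "'l point \<Rightarrow> 'l point"

definition basic_twists :: "'l twist set" where
  "basic_twists = {quarter i \<alpha> ^^ k | i \<alpha> k. k \<in> {1, 2, 3}}"

datatype color = Red | White | Green | Orange | Yellow | Blue | NaC

(* configurations; only values on cells are meaningful *)
type_synonym 'l conf = "'l point \<Rightarrow> color"

definition legal :: "'l conf \<Rightarrow> bool" where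
  "legal f \<longleftrightarrow> (\<forall>c. is_cell c \<longrightarrow> f c \<noteq> NaC)"

definition cells_eq :: "'l conf \<Rightarrow> 'l conf \<Rightarrow> bool" where
  "cells_eq f g \<longleftrightarrow> (\<forall>c. is_cell c \<longrightarrow> f c = g c)"

definition f_solved :: "'l conf" where
  "f_solved p = (case p of (x, y, z) \<Rightarrow>
     if x = PInf then Red else if y = PInf then Blue else if z = PInf then White
     else if x = NInf then Orange else if y = NInf then Green else if z = NInf then Yellow
     else NaC)"

definition act :: "'l twist \<Rightarrow> 'l conf \<Rightarrow> 'l conf" where
  "act \<sigma> f = f \<circ> inv \<sigma>"

(* Ordinal-length sequences: the length theta is represented by a (reflexive) well-order r,
   positions eta < theta are the elements of Field r.  A basic sequence assigns a basic twist
   to every position. *)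
definition basic_seq :: "'i rel \<Rightarrow> ('i \<Rightarrow> 'l twist) \<Rightarrow> bool" where
  "basic_seq r \<sigma> \<longleftrightarrow> Well_order r \<and> (\<forall>\<eta>\<in>Field r. \<sigma> \<eta> \<in> basic_twists)"

definition ev_const :: "'i rel \<Rightarrow> 'i set \<Rightarrow> ('i \<Rightarrow> 'l conf) \<Rightarrow> 'l point \<Rightarrow> color \<Rightarrow> bool" where
  "ev_const r A F c v \<longleftrightarrow> (\<exists>\<xi>\<in>A. \<forall>\<zeta>\<in>A. (\<xi>, \<zeta>) \<in> r \<longrightarrow> F \<zeta> c = v)"

definition lim_conf :: "'i rel \<Rightarrow> 'i set \<Rightarrow> ('i \<Rightarrow> 'l conf) \<Rightarrow> 'l conf" where
  "lim_conf r A F c = (if \<exists>v. ev_const r A F c v then (THE v. ev_const r A F c v) else NaC)"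

(* stages eta \<le> theta: Some eta for eta < theta, None for theta itself;
   preds gives the set of positions strictly below the stage *)
fun preds :: "'i rel \<Rightarrow> 'i option \<Rightarrow> 'i set" where
  "preds r None = Field r"
| "preds r (Some \<eta>) = Order_Relation.underS r \<eta>"

(* g is the run of sigma on f0: g (Some eta) = f_eta, g None = f_theta *)
definition run :: "'i rel \<Rightarrow> ('i \<Rightarrow> 'l twist) \<Rightarrow> 'l conf \<Rightarrow> ('i option \<Rightarrow> 'l conf) \<Rightarrow> bool" where
  "run r \<sigma> f0 g \<longleftrightarrow> (\<forall>\<beta> \<in> insert None (Some ` Field r).
     (let P = preds r \<beta> in
      if P = {} then g \<beta> = f0
      else if (\<exists>\<xi>\<in>P. \<forall>\<zeta>\<in>P. (\<zeta>, \<xi>) \<in> r)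
        then (\<forall>\<xi>\<in>P. (\<forall>\<zeta>\<in>P. (\<zeta>, \<xi>) \<in> r) \<longrightarrow> g \<beta> = act (\<sigma> \<xi>) (g (Some \<xi>)))
      else g \<beta> = lim_conf r P (\<lambda>\<xi>. g (Some \<xi>))))"

definition terminal :: "'i rel \<Rightarrow> ('i \<Rightarrow> 'l twist) \<Rightarrow> 'l conf \<Rightarrow> 'l conf \<Rightarrow> bool" where
  "terminal r \<sigma> f0 f \<longleftrightarrow> (\<exists>g. run r \<sigma> f0 g \<and> cells_eq (g None) f)"

(* Ordinals \<le> omega^2: downward closed subsets S of omega^2 = nat \<times> nat with lexicographic
   order (omega*m + n ~ (m, n)); omega2_on S is the (reflexive) order on S *)
definition lex_le :: "nat \<times> nat \<Rightarrow> nat \<times> nat \<Rightarrow> bool" where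
  "lex_le p q \<longleftrightarrow> fst p < fst q \<or> (fst p = fst q \<and> snd p \<le> snd q)"

definition down_closed :: "(nat \<times> nat) set \<Rightarrow> bool" where
  "down_closed S \<longleftrightarrow> (\<forall>p q. q \<in> S \<longrightarrow> lex_le p q \<longrightarrow> p \<in> S)"

definition omega2_on :: "(nat \<times> nat) set \<Rightarrow> (nat \<times> nat) rel" where
  "omega2_on S = {(p, q). p \<in> S \<and> q \<in> S \<and> lex_le p q}"

end

theory Submission
  imports Defs "HOL-Combinatorics.Permutations"
begin

text \<open>
  Every twist acts on a cell as a rotation of the whole cube, so cells move only inside finite
  clusters, the orbits of the rotation group. The number of cells of a given proper colour in a
  cluster never grows along a run, at limits included; hence in a legal accessible configuration
  every cluster carries the solved distribution of colours, and the six centres are rotated rigidly.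

  Let \<open>a\<close> be a fixed coordinate. The commutator of \<open>[T(x, a), T(z, \<infinity>)]\<close> with the simultaneous turn
  of the slices \<open>y = s\<close>, for \<open>s\<close> in a set \<open>Z\<close>, is a three-cycle in the cluster of \<open>(a, s, \<infinity>)\<close> for
  each \<open>s\<close> in \<open>Z\<close> and the identity elsewhere. Its conjugates connect all cells of a cluster, so they
  generate the alternating group, and since colours repeat that suffices to solve a cluster. As
  there are only finitely many permutations of a cluster, finitely many simultaneous turns solve all
  clusters of the given \<open>a\<close> at once, and each simultaneous turn takes \<open>\<omega>\<close> moves.

  The coordinates are treated one after the other. The turns used for the \<open>k\<close>-th coordinate are face
  turns and slice turns of index at least \<open>k\<close>. Cells whose two finite coordinates have index below
  \<open>k\<close> are already solved: slice turns do not touch them, and face turns exchange them only with cells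
  of the same colour. Hence all colours converge at \<open>\<omega>\<^sup>2\<close>.
\<close>

section \<open>Rotations and slice turns\<close>

fun rot :: "axis \<Rightarrow> 'l point \<Rightarrow> 'l point" where
  "rot AX (x, y, z) = (x, neg z, y)"
| "rot AY (x, y, z) = (z, y, neg x)"
| "rot AZ (x, y, z) = (neg y, x, z)"

fun prj :: "axis \<Rightarrow> 'l point \<Rightarrow> 'l coord" where
  "prj AX (x, y, z) = x"
| "prj AY (x, y, z) = y"
| "prj AZ (x, y, z) = z"

text \<open>The exponent function lets infinitely many parallel slices turn at once. Since
  \<open>rot i\<close> keeps the \<open>i\<close>-coordinate, turns about one axis compose by adding
  exponents, and only residues modulo 4 matter; hence \<open>3 * e\<close> gives the
  inverse.\<close>

definition slice :: "axis \<Rightarrow> ('l coord \<Rightarrow> nat) \<Rightarrow> 'l twist" where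
  "slice i e p = (rot i ^^ e (prj i p)) p"

lemma neg_neg [simp]: "neg (neg a) = a"
  by (cases a) auto

lemma neg_eq_iff [simp]: "neg a = neg b \<longleftrightarrow> a = b"
  by (metis neg_neg)

lemma is_inf_simps [simp]: "is_inf PInf" "is_inf NInf" "\<not> is_inf (Pos l)" "\<not> is_inf (Neg l)"
  "\<not> is_inf Zero" "is_inf (neg a) = is_inf a"
  by (cases a; simp add: is_inf_def)+

lemma neg_eq_simps [simp]:
  "neg a = PInf \<longleftrightarrow> a = NInf" "neg a = NInf \<longleftrightarrow> a = PInf" "neg a = Zero \<longleftrightarrow> a = Zero"
  "neg a = Pos l \<longleftrightarrow> a = Neg l" "neg a = Neg l \<longleftrightarrow> a = Pos l"
  "neg a = a \<longleftrightarrow> a = Zero" "a = neg a \<longleftrightarrow> a = Zero"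
  by (cases a; auto)+

lemma rot4 [simp]: "rot i (rot i (rot i (rot i p))) = p"
  by (cases i; cases p) auto

lemma prj_rot [simp]: "prj i (rot i p) = prj i p"
  by (cases i; cases p) auto

lemma prj_rot_pow [simp]: "prj i ((rot i ^^ n) p) = prj i p"
  by (induction n) auto

lemma prj_slice [simp]: "prj i (slice i e p) = prj i p"
  by (simp add: slice_def)

lemma rot_pow_mult4 [simp]: "(rot i ^^ (4 * n)) p = p"
  by (induction n) (auto simp: numeral_eq_Suc)

lemma rot_pow_mod4: "(rot i ^^ (n mod 4)) p = (rot i ^^ n) p"
proof -
  have "(rot i ^^ n) p = (rot i ^^ (n mod 4 + 4 * (n div 4))) p" by simp
  also have "\<dots> = (rot i ^^ (n mod 4)) p" by (simp only: funpow_add o_apply rot_pow_mult4)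
  finally show ?thesis by simp
qed

lemma slice_slice: "slice i e (slice i e' p) = slice i (\<lambda>\<alpha>. e \<alpha> + e' \<alpha>) p"
  by (simp add: slice_def funpow_add)

lemma slice_comp: "slice i e \<circ> slice i e' = slice i (\<lambda>\<alpha>. e \<alpha> + e' \<alpha>)"
  by (simp add: fun_eq_iff slice_slice)

lemma slice_mod4: "(\<And>\<alpha>. e \<alpha> mod 4 = e' \<alpha> mod 4) \<Longrightarrow> slice i e = slice i e'"
  by (metis ext rot_pow_mod4 slice_def)

lemma slice_zero: "slice i (\<lambda>\<alpha>. 0) = id"
  by (simp add: fun_eq_iff slice_def)

lemma slice_inverse:
  "slice i e \<circ> slice i (\<lambda>\<alpha>. 3 * e \<alpha>) = id" "slice i (\<lambda>\<alpha>. 3 * e \<alpha>) \<circ> slice i e = id"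
  unfolding slice_comp slice_zero[of i, symmetric] by (rule slice_mod4, presburger)+

lemma bij_slice [simp]: "bij (slice i e)"
  using o_bij slice_inverse by blast

lemma inv_slice: "inv (slice i e) = slice i (\<lambda>\<alpha>. 3 * e \<alpha>)"
  by (rule inv_unique_comp) (rule slice_inverse)+

lemma quarter_eq: "quarter i \<alpha> p = (if prj i p = \<alpha> then rot i p else p)"
  by (cases i; cases p) auto

lemma quarter_pow: "quarter i \<alpha> ^^ k = slice i (\<lambda>\<beta>. if \<beta> = \<alpha> then k else 0)"
proof (induction k)
  case (Suc k)
  have "quarter i \<alpha> = slice i (\<lambda>\<beta>. if \<beta> = \<alpha> then 1 else 0)"
    by (simp add: fun_eq_iff quarter_eq slice_def)
  then show ?case
    using Suc by (simp add: slice_comp if_distrib cong: if_cong)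
qed (simp add: fun_eq_iff slice_def)

section \<open>The rotation group of the cube\<close>

inductive_set rots :: "('l point \<Rightarrow> 'l point) set" where
  rots_id: "id \<in> rots"
| rots_X: "\<rho> \<in> rots \<Longrightarrow> \<rho> \<circ> rot AX \<in> rots"
| rots_Y: "\<rho> \<in> rots \<Longrightarrow> \<rho> \<circ> rot AY \<in> rots"

lemma rots_comp: "\<rho>' \<in> rots \<Longrightarrow> \<rho> \<in> rots \<Longrightarrow> \<rho> \<circ> \<rho>' \<in> rots"
  by (induction rule: rots.induct) (auto simp: o_assoc intro: rots.intros)

lemma rot_in_rots: "rot i \<in> rots"
proof (cases i)
  case AZ
  have "rot AZ = ((((id \<circ> rot AX) \<circ> rot AY) \<circ> rot AX) \<circ> rot AX) \<circ> rot AX"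
    by (simp add: fun_eq_iff)
  then show ?thesis using AZ by (metis rots.intros)
qed (metis id_comp rots.intros)+

lemma rots_inverse:
  fixes \<rho> :: "'l point \<Rightarrow> 'l point"
  shows "\<rho> \<in> rots \<Longrightarrow> \<exists>\<rho>'\<in>rots. \<rho> \<circ> \<rho>' = id \<and> \<rho>' \<circ> \<rho> = id"
proof -
  have step: "\<exists>\<tau>\<in>rots. (\<rho> \<circ> rot i) \<circ> \<tau> = id \<and> \<tau> \<circ> (\<rho> \<circ> rot i) = id"
    if "\<exists>\<rho>'\<in>rots. \<rho> \<circ> \<rho>' = id \<and> \<rho>' \<circ> \<rho> = id" for \<rho> :: "'l point \<Rightarrow> 'l point" and i
  proof -
    from that obtain \<rho>' where r: "\<rho>' \<in> rots" "\<rho> \<circ> \<rho>' = id" "\<rho>' \<circ> \<rho> = id" by blast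
    then have "\<rho> (\<rho>' p) = p" "\<rho>' (\<rho> p) = p" for p by (metis comp_apply id_apply)+
    then have "(\<rho> \<circ> rot i) \<circ> (rot i \<circ> rot i \<circ> rot i \<circ> \<rho>') = id"
      "(rot i \<circ> rot i \<circ> rot i \<circ> \<rho>') \<circ> (\<rho> \<circ> rot i) = id"
      by (simp_all add: fun_eq_iff del: split_paired_All)
    moreover have "rot i \<circ> rot i \<circ> rot i \<circ> \<rho>' \<in> rots"
      by (intro rots_comp r rot_in_rots)
    ultimately show ?thesis by blast
  qed
  show "\<rho> \<in> rots \<Longrightarrow> \<exists>\<rho>'\<in>rots. \<rho> \<circ> \<rho>' = id \<and> \<rho>' \<circ> \<rho> = id"
  proof (induction rule: rots.induct)
    case rots_id
    show ?case by (intro bexI[of _ id] rots.rots_id) simp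
  qed (blast intro: step)+
qed

lemma rots_bij: "\<rho> \<in> rots \<Longrightarrow> bij \<rho>"
  by (metis o_bij rots_inverse)

lemma bij_rot: "bij (rot i)"
  by (rule rots_bij[OF rot_in_rots])

lemma rots_inv: "\<rho> \<in> rots \<Longrightarrow> inv \<rho> \<in> rots"
  by (metis inv_unique_comp rots_inverse)

abbreviation rot_fun :: "('l point \<Rightarrow> 'l coord) \<Rightarrow> ('l point \<Rightarrow> 'l coord) \<Rightarrow> ('l point \<Rightarrow> 'l coord)
    \<Rightarrow> 'l point \<Rightarrow> 'l point" where
  "rot_fun f g h \<equiv> \<lambda>p. (f p, g p, h p)"

text \<open>These are the 24 signed coordinate permutations of determinant one: even permutations
  carry an even number of signs, odd ones an odd number. The list yields finiteness and settles by
  cases which rotations fix or identify given points.\<close>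

lemma rots_explicit:
  assumes "\<rho> \<in> rots"
  shows "\<rho> \<in> (let X = prj AX; Y = prj AY; Z = prj AZ; X' = neg \<circ> X; Y' = neg \<circ> Y; Z' = neg \<circ> Z in
    {rot_fun X Y Z, rot_fun X Y' Z', rot_fun X' Y Z', rot_fun X' Y' Z,
     rot_fun Y Z X, rot_fun Y Z' X', rot_fun Y' Z X', rot_fun Y' Z' X,
     rot_fun Z X Y, rot_fun Z X' Y', rot_fun Z' X Y', rot_fun Z' X' Y,
     rot_fun Y X Z', rot_fun Y X' Z, rot_fun Y' X Z, rot_fun Y' X' Z',
     rot_fun X Z Y', rot_fun X Z' Y, rot_fun X' Z Y, rot_fun X' Z' Y',
     rot_fun Z Y X', rot_fun Z Y' X, rot_fun Z' Y X, rot_fun Z' Y' X'})"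
proof -
  have prj_simps: "prj AX = fst" "prj AY = fst \<circ> snd" "prj AZ = snd \<circ> snd"
    by (auto simp: fun_eq_iff)
  have rot_eqs: "rot AX = (\<lambda>p. (fst p, neg (snd (snd p)), fst (snd p)))"
     "rot AY = (\<lambda>p. (snd (snd p), fst (snd p), neg (fst p)))"
    by (auto simp: fun_eq_iff)
  show ?thesis
    using assms unfolding Let_def
  proof (induction \<rho> rule: rots.induct)
    case rots_id
    show ?case by (simp add: prj_simps fun_eq_iff)
  next
    case (rots_X \<rho>)
    then show ?case
      unfolding insert_iff empty_iff
      by (elim disjE; simp only: prj_simps rot_eqs comp_def fst_conv snd_conv neg_neg simp_thms)
  next
    case (rots_Y \<rho>)
    then show ?case
      unfolding insert_iff empty_iff
      by (elim disjE; simp only: prj_simps rot_eqs comp_def fst_conv snd_conv neg_neg simp_thms)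
  qed
qed

lemma finite_rots [simp]: "finite rots"
  by (rule finite_subset[OF subsetI[OF rots_explicit]]) (auto simp: Let_def)

section \<open>Finite products of simultaneous slice turns\<close>

inductive_set moves :: "'l coord set \<Rightarrow> 'l twist set" for D where
  moves_id: "id \<in> moves D"
| moves_slice: "m \<in> moves D \<Longrightarrow> (\<And>\<alpha>. \<alpha> \<notin> D \<Longrightarrow> e \<alpha> = 0) \<Longrightarrow> slice i e \<circ> m \<in> moves D"

lemma slice_in_moves: "(\<And>\<alpha>. \<alpha> \<notin> D \<Longrightarrow> e \<alpha> = 0) \<Longrightarrow> slice i e \<in> moves D"
  by (metis comp_id moves.intros)

lemma moves_comp: "m \<in> moves D \<Longrightarrow> m' \<in> moves D \<Longrightarrow> m \<circ> m' \<in> moves D"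
  by (induction rule: moves.induct) (auto simp: comp_assoc intro: moves.intros)

lemma moves_bij: "m \<in> moves D \<Longrightarrow> bij m"
  by (induction rule: moves.induct) (rule bij_id, rule bij_comp, assumption, rule bij_slice)

lemma moves_inv: "m \<in> moves D \<Longrightarrow> inv m \<in> moves D"
proof (induction rule: moves.induct)
  case (moves_slice m e i)
  then have "inv (slice i e \<circ> m) = inv m \<circ> slice i (\<lambda>\<alpha>. 3 * e \<alpha>)"
    by (simp add: o_inv_distrib moves_bij inv_slice)
  then show ?case
    using moves_slice by (simp only:) (rule moves_comp slice_in_moves | simp)+
qed (simp only: inv_id moves.moves_id)

text \<open>A rotation carries the slices of one axis to those of another. Where it reverses the
  direction of the axis, slice coordinates are negated and turns change sense, which produces
  \<open>3 * e (neg \<alpha>)\<close>.\<close>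

lemma slice_conj_rot:
  fixes e :: "'l coord \<Rightarrow> nat"
  shows "rot AX \<circ> slice AX e = slice AX e \<circ> rot AX"
    "rot AX \<circ> slice AY e = slice AZ e \<circ> rot AX"
    "rot AX \<circ> slice AZ e = slice AY (\<lambda>\<alpha>. 3 * e (neg \<alpha>)) \<circ> rot AX"
    "rot AY \<circ> slice AY e = slice AY e \<circ> rot AY"
    "rot AY \<circ> slice AZ e = slice AX e \<circ> rot AY"
    "rot AY \<circ> slice AX e = slice AZ (\<lambda>\<alpha>. 3 * e (neg \<alpha>)) \<circ> rot AY"
proof -
  have pow: "rot i ((rot i' ^^ n) p) = (rot j ^^ n) (rot i p)"
    if "\<And>p :: 'l point. rot i (rot i' p) = rot j (rot i p)" for i i' j n and p :: "'l point"
    by (induction n) (simp_all only: funpow.simps o_apply id_apply that)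
  have pow3: "rot i ((rot i' ^^ n) p) = (rot j ^^ (3 * n)) (rot i p)"
    if "\<And>p :: 'l point. rot i (rot i' p) = rot j (rot j (rot j (rot i p)))" for i i' j n and p :: "'l point"
    by (induction n) (simp_all only: mult_Suc_right mult_0_right numeral_3_eq_3 add_Suc add_0 funpow.simps o_apply id_apply that)
  have prjs: "prj AX (rot AX p) = prj AX p" "prj AZ (rot AX p) = prj AY p" "prj AY (rot AX p) = neg (prj AZ p)"
    "prj AY (rot AY p) = prj AY p" "prj AX (rot AY p) = prj AZ p" "prj AZ (rot AY p) = neg (prj AX p)" for p :: "'l point"
    by (cases p; simp)+
  have "rot AX (rot AX p) = rot AX (rot AX p)" for p :: "'l point"
    by (cases p) simp
  from pow[OF this] show "rot AX \<circ> slice AX e = slice AX e \<circ> rot AX"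
    by (intro ext) (simp add: slice_def)
  have "rot AX (rot AY p) = rot AZ (rot AX p)" for p :: "'l point"
    by (cases p) simp
  from pow[OF this] show "rot AX \<circ> slice AY e = slice AZ e \<circ> rot AX"
    by (intro ext) (simp only: o_apply slice_def prjs neg_neg)
  have "rot AX (rot AZ p) = rot AY (rot AY (rot AY (rot AX p)))" for p :: "'l point"
    by (cases p) simp
  from pow3[OF this] show "rot AX \<circ> slice AZ e = slice AY (\<lambda>\<alpha>. 3 * e (neg \<alpha>)) \<circ> rot AX"
    by (intro ext) (simp only: o_apply slice_def prjs neg_neg)
  have "rot AY (rot AY p) = rot AY (rot AY p)" for p :: "'l point"
    by (cases p) simp
  from pow[OF this] show "rot AY \<circ> slice AY e = slice AY e \<circ> rot AY"
    by (intro ext) (simp add: slice_def)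
  have "rot AY (rot AZ p) = rot AX (rot AY p)" for p :: "'l point"
    by (cases p) simp
  from pow[OF this] show "rot AY \<circ> slice AZ e = slice AX e \<circ> rot AY"
    by (intro ext) (simp only: o_apply slice_def prjs neg_neg)
  have "rot AY (rot AX p) = rot AZ (rot AZ (rot AZ (rot AY p)))" for p :: "'l point"
    by (cases p) simp
  from pow3[OF this] show "rot AY \<circ> slice AX e = slice AZ (\<lambda>\<alpha>. 3 * e (neg \<alpha>)) \<circ> rot AY"
    by (intro ext) (simp only: o_apply slice_def prjs neg_neg)
qed

lemma moves_conj_rot:
  assumes D: "\<And>\<alpha>. neg \<alpha> \<in> D \<longleftrightarrow> \<alpha> \<in> D" and "m \<in> moves D" and i: "i = AX \<or> i = AY"
  shows "\<exists>m'\<in>moves D. rot i \<circ> m = m' \<circ> rot i"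
  using assms(2)
proof (induction rule: moves.induct)
  case (moves_slice m e j)
  then obtain m' where m': "m' \<in> moves D" "rot i \<circ> m = m' \<circ> rot i" by blast
  obtain j' e' where e': "rot i \<circ> slice j e = slice j' e' \<circ> rot i" "\<And>\<alpha>. \<alpha> \<notin> D \<Longrightarrow> e' \<alpha> = 0"
  proof -
    have e2: "3 * e (neg \<alpha>) = 0" if "\<alpha> \<notin> D" for \<alpha> using that moves_slice(2) D by simp
    show ?thesis
      using i by (cases j) (use moves_slice(2) e2 slice_conj_rot that in \<open>metis (no_types, lifting)\<close>)+
  qed
  have "rot i \<circ> (slice j e \<circ> m) = (slice j' e' \<circ> m') \<circ> rot i"
    using m'(2) e'(1) by (metis comp_assoc)
  then show ?case using m' e' by (blast intro: moves.intros)
qed (metis moves.moves_id comp_id id_comp)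

text \<open>The symmetry of \<open>D\<close> absorbs the sign changes of
  \<open>slice_conj_rot\<close>. Thus one three-cycle in a cluster yields all its rotated copies
  without further slices being turned.\<close>

lemma moves_conj:
  assumes D: "\<And>\<alpha>. neg \<alpha> \<in> D \<longleftrightarrow> \<alpha> \<in> D" and "\<rho> \<in> rots"
  shows "m \<in> moves D \<Longrightarrow> \<rho> \<circ> m \<circ> inv \<rho> \<in> moves D"
  using assms(2)
proof (induction arbitrary: m rule: rots.induct)
  have step: "(\<rho> \<circ> rot i) \<circ> m \<circ> inv (\<rho> \<circ> rot i) \<in> moves D"
    if \<rho>: "\<rho> \<in> rots" and IH: "\<And>m. m \<in> moves D \<Longrightarrow> \<rho> \<circ> m \<circ> inv \<rho> \<in> moves D"
      and m: "m \<in> moves D" and i: "i = AX \<or> i = AY" for \<rho> m i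
  proof -
    obtain m' where m': "m' \<in> moves D" "rot i \<circ> m = m' \<circ> rot i"
      using moves_conj_rot[OF D m i] by blast
    have "rot i \<circ> m \<circ> inv (rot i) = m'"
      by (metis m'(2) comp_assoc comp_id surj_iff bij_is_surj bij_rot)
    moreover have "inv (\<rho> \<circ> rot i) = inv (rot i) \<circ> inv \<rho>"
      using \<rho> by (simp add: o_inv_distrib rots_bij bij_rot)
    moreover have "(\<rho> \<circ> rot i) \<circ> m \<circ> (inv (rot i) \<circ> inv \<rho>) = \<rho> \<circ> (rot i \<circ> m \<circ> inv (rot i)) \<circ> inv \<rho>"
      by (simp only: comp_assoc)
    ultimately have "(\<rho> \<circ> rot i) \<circ> m \<circ> inv (\<rho> \<circ> rot i) = \<rho> \<circ> m' \<circ> inv \<rho>"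
      by (simp only:)
    then show ?thesis using IH m' by simp
  qed
  {
    case (rots_X \<rho>)
    then show ?case using step by blast
  next
    case (rots_Y \<rho>)
    then show ?case using step by blast
  }
qed simp

section \<open>Clusters and centres\<close>

definition orb :: "'l point \<Rightarrow> 'l point set" where
  "orb q = (\<lambda>\<rho>. \<rho> q) ` rots"

lemma orb_finite [simp]: "finite (orb q)"
  by (simp add: orb_def)

lemma orb_refl [simp]: "q \<in> orb q"
  by (metis id_apply image_eqI orb_def rots_id)

lemma orb_rots: "\<rho> \<in> rots \<Longrightarrow> p \<in> orb q \<Longrightarrow> \<rho> p \<in> orb q"
  by (auto simp: orb_def) (metis comp_apply image_eqI rots_comp)

lemma orb_rot_pow: "p \<in> orb q \<Longrightarrow> (rot i ^^ n) p \<in> orb q"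
  by (induction n) (auto intro: orb_rots rot_in_rots)

lemma orb_moves: "m \<in> moves D \<Longrightarrow> p \<in> orb q \<Longrightarrow> m p \<in> orb q"
  by (induction rule: moves.induct) (auto simp: slice_def intro: orb_rot_pow)

lemma bij_betw_moves_orb:
  assumes "m \<in> moves D"
  shows "bij_betw m (orb q) (orb q)"
proof (rule bij_betw_byWitness[where f' = "inv m"])
  show "\<forall>a\<in>orb q. inv m (m a) = a" "\<forall>a\<in>orb q. m (inv m a) = a"
    using moves_bij[OF assms] by (auto simp: bij_is_inj surj_f_inv_f bij_is_surj)
qed (use orb_moves assms moves_inv in blast)+

lemma basic_twist_is_slice: "\<sigma> \<in> basic_twists \<Longrightarrow> \<exists>i e. \<sigma> = slice i e"
  by (auto simp: basic_twists_def quarter_pow)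

lemma is_cell_rots: "\<rho> \<in> rots \<Longrightarrow> is_cell (\<rho> p) = is_cell p"
proof (induction arbitrary: p rule: rots.induct)
  case (rots_X \<rho>)
  then show ?case by (cases p) (auto simp: is_cell_def)
next
  case (rots_Y \<rho>)
  then show ?case by (cases p) (auto simp: is_cell_def)
qed simp

lemma is_cell_orb: "p \<in> orb q \<Longrightarrow> is_cell p = is_cell q"
  by (auto simp: orb_def is_cell_rots)

abbreviation centres :: "'l point set" where
  "centres \<equiv> orb (Zero, Zero, PInf)"

lemma is_cell_centre: "is_cell (Zero, Zero, PInf)"
  by (simp add: is_cell_def)

text \<open>A centre has a single nonzero coordinate, so if that is the \<open>i\<close>-coordinate,
  the centre lies on the axis of \<open>rot i\<close>.\<close>

lemma centre_fixed:
  fixes c :: "'l point"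
  assumes "c \<in> centres" "prj i c \<noteq> Zero"
  shows "rot i c = c"
proof -
  obtain \<rho> :: "'l point \<Rightarrow> 'l point" where "\<rho> \<in> rots" "c = \<rho> (Zero, Zero, PInf)"
    using assms(1) by (auto simp: orb_def)
  then show ?thesis
    using rots_explicit[OF \<open>\<rho> \<in> rots\<close>] assms(2)
    by (cases i) (auto simp: Let_def)
qed

text \<open>Only the middle slice moves centres, so a simultaneous turn moves all six by one
  rotation. This keeps their arrangement rigid.\<close>

lemma slice_centre: "c \<in> centres \<Longrightarrow> slice i e c = (rot i ^^ e Zero) c"
proof (cases "prj i c = Zero")
  case False
  assume "c \<in> centres"
  then have "(rot i ^^ n) c = c" for n
    using False by (induction n) (auto simp: centre_fixed)
  then show ?thesis by (simp add: slice_def)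
qed (simp add: slice_def)

section \<open>Invariants of legal runs\<close>

text \<open>Both clauses are weak enough to survive limits, where cells may become
  \<open>NaC\<close>: counts of proper colours are only bounded above, and a centre may have lost
  its colour. Each instance concerns finitely many cells.\<close>

definition consistent :: "'l conf \<Rightarrow> bool" where
  "consistent h \<longleftrightarrow>
     (\<forall>q v. is_cell q \<longrightarrow> v \<noteq> NaC \<longrightarrow> card {c \<in> orb q. h c = v} \<le> card {c \<in> orb q. f_solved c = v}) \<and>
     (\<exists>\<rho>\<in>rots. \<forall>c\<in>centres. h c = NaC \<or> h c = f_solved (\<rho> c))"

lemma consistent_solved: "consistent f_solved"
  by (auto simp: consistent_def intro!: bexI[OF _ rots_id])

lemma consistent_cong:
  assumes "consistent g" "cells_eq g f"
  shows "consistent f"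
proof -
  have eq: "g c = f c" if "c \<in> orb q" "is_cell q" for c q
    using assms(2) that is_cell_orb unfolding cells_eq_def by blast
  have "\<forall>c\<in>centres. f c = g c" using eq[OF _ is_cell_centre] by simp
  then obtain \<rho> where "\<rho> \<in> rots" "\<forall>c\<in>centres. f c = NaC \<or> f c = f_solved (\<rho> c)"
    using assms(1) unfolding consistent_def by (auto simp del: split_paired_All)
  moreover have "card {c \<in> orb q. f c = v} \<le> card {c \<in> orb q. f_solved c = v}"
    if "is_cell q" "v \<noteq> NaC" for q v
  proof -
    have "{c \<in> orb q. f c = v} = {c \<in> orb q. g c = v}" using eq[OF _ that(1)] by (intro Collect_cong) auto
    then show ?thesis using assms(1) that unfolding consistent_def by (simp only:) blast
  qed
  ultimately show ?thesis unfolding consistent_def by blast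
qed

lemma rot_pow_in_rots: "rot i ^^ n \<in> rots"
  by (induction n) (simp_all only: funpow.simps rots_comp rots_id rot_in_rots)

lemma consistent_act:
  assumes "consistent h" and "\<sigma> \<in> basic_twists"
  shows "consistent (act \<sigma> h)"
proof -
  obtain i e where \<sigma>: "\<sigma> = slice i e" using basic_twist_is_slice assms(2) by blast
  define m where "m = inv \<sigma>"
  have m: "m \<in> moves UNIV" and m': "m = slice i (\<lambda>\<alpha>. 3 * e \<alpha>)"
    using inv_slice by (auto simp: m_def \<sigma> intro: slice_in_moves moves_inv)
  have "card {c \<in> orb q. h (m c) = v} = card {c \<in> orb q. h c = v}" for q v
  proof (rule bij_betw_same_card[of m])
    show "bij_betw m {c \<in> orb q. h (m c) = v} {c \<in> orb q. h c = v}"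
    proof -
      have "m ` {c \<in> orb q. h (m c) = v} = {c \<in> m ` orb q. h c = v}" by blast
      moreover note bij = bij_betw_moves_orb[OF m, of q]
      ultimately show ?thesis
        by (intro bij_betw_subset[OF bij]) (simp_all add: bij_betw_imp_surj_on[OF bij])
    qed
  qed
  moreover obtain \<rho> where \<rho>: "\<rho> \<in> rots" "\<forall>c\<in>centres. h c = NaC \<or> h c = f_solved (\<rho> c)"
    using assms(1) by (auto simp: consistent_def)
  have "\<forall>c\<in>centres. h (m c) = NaC \<or> h (m c) = f_solved ((\<rho> \<circ> rot i ^^ (3 * e Zero)) c)"
  proof
    fix c :: "'a point" assume c: "c \<in> centres"
    then have "m c = (rot i ^^ (3 * e Zero)) c" by (simp add: m' slice_centre)
    then show "h (m c) = NaC \<or> h (m c) = f_solved ((\<rho> \<circ> rot i ^^ (3 * e Zero)) c)"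
      using \<rho> c orb_moves[OF m] by (metis comp_apply)
  qed
  moreover have "\<rho> \<circ> rot i ^^ (3 * e Zero) \<in> rots"
    using \<rho>(1) rot_pow_in_rots by (blast intro: rots_comp)
  ultimately show ?thesis
    using assms(1) unfolding consistent_def act_def m_def[symmetric] 
    by (intro conjI bexI[of _ "\<rho> \<circ> rot i ^^ (3 * e Zero)"]) simp_all
qed

text \<open>On a whole cluster, being finite, some stage agrees with the limit wherever the limit is
  not \<open>NaC\<close>, and the clauses transfer from that stage. The rotation of the centres may
  vary from stage to stage.\<close>

lemma consistent_limit:
  fixes h :: "'l conf"
  assumes F: "\<And>\<xi>. \<xi> \<in> P \<Longrightarrow> consistent (F \<xi>)"
    and approx: "\<And>C. finite C \<Longrightarrow> \<exists>\<xi>\<in>P. \<forall>c\<in>C. h c = NaC \<or> F \<xi> c = h c"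
  shows "consistent h"
  unfolding consistent_def
proof (intro conjI allI impI)
  fix q :: "'l point" and v assume v: "is_cell q" "v \<noteq> NaC"
  obtain \<xi> where "\<xi> \<in> P" "\<forall>c\<in>orb q. h c = NaC \<or> F \<xi> c = h c"
    using approx[OF orb_finite] by blast
  moreover from this have "card {c \<in> orb q. h c = v} \<le> card {c \<in> orb q. F \<xi> c = v}"
    using v(2) by (intro card_mono) auto
  ultimately show "card {c \<in> orb q. h c = v} \<le> card {c \<in> orb q. f_solved c = v}"
    using F v order_trans unfolding consistent_def by blast
next
  obtain \<xi> where \<xi>: "\<xi> \<in> P" "\<forall>c\<in>centres. h c = NaC \<or> F \<xi> c = h c"
    using approx[OF orb_finite] by blast
  then obtain \<rho> where "\<rho> \<in> rots" "\<forall>c\<in>centres. F \<xi> c = NaC \<or> F \<xi> c = f_solved (\<rho> c)"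
    using F unfolding consistent_def by blast
  then show "\<exists>\<rho>\<in>rots. \<forall>c\<in>centres. h c = NaC \<or> h c = f_solved (\<rho> c)"
    using \<xi> by metis
qed

section \<open>Limits of configurations\<close>

lemma ev_const_unique:
  assumes lin: "\<And>\<xi> \<zeta>. \<xi> \<in> P \<Longrightarrow> \<zeta> \<in> P \<Longrightarrow> (\<xi>, \<zeta>) \<in> r \<or> (\<zeta>, \<xi>) \<in> r"
    and "\<And>\<xi>. \<xi> \<in> P \<Longrightarrow> (\<xi>, \<xi>) \<in> r"
    and "ev_const r P F c v" "ev_const r P F c w"
  shows "v = w"
  using assms unfolding ev_const_def by metis

lemma lim_conf_eq:
  assumes lin: "\<And>\<xi> \<zeta>. \<xi> \<in> P \<Longrightarrow> \<zeta> \<in> P \<Longrightarrow> (\<xi>, \<zeta>) \<in> r \<or> (\<zeta>, \<xi>) \<in> r"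
    and "\<And>\<xi>. \<xi> \<in> P \<Longrightarrow> (\<xi>, \<xi>) \<in> r"
    and "ev_const r P F c v"
  shows "lim_conf r P F c = v"
  unfolding lim_conf_def using assms ev_const_unique[of P r F c]
  by (metis (mono_tags, lifting) the_equality)

text \<open>Finitely many eventually constant colours are all constant beyond the largest of their
  thresholds; cells without a limit are \<open>NaC\<close> and impose nothing.\<close>

lemma lim_conf_approx:
  assumes lin: "\<And>\<xi> \<zeta>. \<xi> \<in> P \<Longrightarrow> \<zeta> \<in> P \<Longrightarrow> (\<xi>, \<zeta>) \<in> r \<or> (\<zeta>, \<xi>) \<in> r"
    and refl: "\<And>\<xi>. \<xi> \<in> P \<Longrightarrow> (\<xi>, \<xi>) \<in> r" and "trans r" and "P \<noteq> {}" and "finite C"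
  shows "\<exists>\<xi>\<in>P. \<forall>\<zeta>\<in>P. (\<xi>, \<zeta>) \<in> r \<longrightarrow> (\<forall>c\<in>C. lim_conf r P F c = NaC \<or> F \<zeta> c = lim_conf r P F c)"
  using \<open>finite C\<close>
proof (induction C rule: finite_induct)
  case (insert c C)
  then obtain \<xi> where \<xi>: "\<xi> \<in> P"
    "\<forall>\<zeta>\<in>P. (\<xi>, \<zeta>) \<in> r \<longrightarrow> (\<forall>c\<in>C. lim_conf r P F c = NaC \<or> F \<zeta> c = lim_conf r P F c)" by blast
  show ?case
  proof (cases "\<exists>v. ev_const r P F c v")
    case True
    then have "ev_const r P F c (lim_conf r P F c)"
      using lim_conf_eq[OF lin refl] by blast
    then obtain \<xi>' where "\<xi>' \<in> P" "\<forall>\<zeta>\<in>P. (\<xi>', \<zeta>) \<in> r \<longrightarrow> F \<zeta> c = lim_conf r P F c"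
      by (auto simp: ev_const_def)
    then show ?thesis
      using \<xi> lin[of \<xi> \<xi>'] transD[OF \<open>trans r\<close>] by (metis insert_iff)
  next
    case False
    then have "lim_conf r P F c = NaC" by (simp add: lim_conf_def)
    then show ?thesis using \<xi> by (metis insert_iff)
  qed
qed (use \<open>P \<noteq> {}\<close> in auto)

lemma run_consistent:
  assumes seq: "basic_seq r \<sigma>" and run: "run r \<sigma> f_solved g"
  shows "consistent (g None)"
proof -
  have wo: "Well_order r" and tw: "\<And>\<eta>. \<eta> \<in> Field r \<Longrightarrow> \<sigma> \<eta> \<in> basic_twists"
    using seq by (auto simp: basic_seq_def)
  then have tr: "trans r" and tot: "Total r" and rf: "Refl r"
    by (auto simp: order_on_defs)
  have lin: "(\<xi>, \<zeta>) \<in> r \<or> (\<zeta>, \<xi>) \<in> r" if "\<xi> \<in> Field r" "\<zeta> \<in> Field r" for \<xi> \<zeta>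
    using that tot rf by (metis refl_onD total_on_def)
  \<comment> \<open>The clauses of \<open>run\<close> are handled for an arbitrary stage, so the
    same fact serves the induction over positions and then the terminal stage
    \<open>None\<close>.\<close>
  have step: "consistent (g \<beta>)"
    if \<beta>: "\<beta> \<in> insert None (Some ` Field r)" and IH: "\<And>\<xi>. \<xi> \<in> preds r \<beta> \<Longrightarrow> consistent (g (Some \<xi>))"
    for \<beta>
  proof -
    have sub: "preds r \<beta> \<subseteq> Field r" 
      by (cases \<beta>) (auto simp: underS_def Field_def)
    have R: "let P = preds r \<beta> in
      if P = {} then g \<beta> = f_solved
      else if (\<exists>\<xi>\<in>P. \<forall>\<zeta>\<in>P. (\<zeta>, \<xi>) \<in> r)
        then (\<forall>\<xi>\<in>P. (\<forall>\<zeta>\<in>P. (\<zeta>, \<xi>) \<in> r) \<longrightarrow> g \<beta> = act (\<sigma> \<xi>) (g (Some \<xi>)))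
      else g \<beta> = lim_conf r P (\<lambda>\<xi>. g (Some \<xi>))"
      using run \<beta> unfolding run_def by blast
    consider "preds r \<beta> = {}" | \<xi> where "\<xi> \<in> preds r \<beta>" "\<forall>\<zeta>\<in>preds r \<beta>. (\<zeta>, \<xi>) \<in> r"
      | "preds r \<beta> \<noteq> {}" "\<not> (\<exists>\<xi>\<in>preds r \<beta>. \<forall>\<zeta>\<in>preds r \<beta>. (\<zeta>, \<xi>) \<in> r)"
      by blast
    then show ?thesis
    proof cases
      case 1
      then show ?thesis using R consistent_solved by (simp add: Let_def)
    next
      case 2
      then have "g \<beta> = act (\<sigma> \<xi>) (g (Some \<xi>))"
        using R by (auto simp: Let_def split: if_splits)
      then show ?thesis using 2 IH sub tw consistent_act by (metis subsetD)
    next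
      case 3
      then have g: "g \<beta> = lim_conf r (preds r \<beta>) (\<lambda>\<xi>. g (Some \<xi>))"
        using R by (simp add: Let_def)
      show ?thesis
      proof (rule consistent_limit[where F = "\<lambda>\<xi>. g (Some \<xi>)" and P = "preds r \<beta>"])
        fix C :: "'b point set" assume "finite C"
        from lim_conf_approx[OF _ _ tr 3(1) this, of "\<lambda>\<xi>. g (Some \<xi>)"] lin sub
        obtain \<xi> where \<xi>: "\<xi> \<in> preds r \<beta>" "\<forall>\<zeta>\<in>preds r \<beta>. (\<xi>, \<zeta>) \<in> r \<longrightarrow>
            (\<forall>c\<in>C. g \<beta> c = NaC \<or> g (Some \<zeta>) c = g \<beta> c)"
          unfolding g by blast
        moreover have "(\<xi>, \<xi>) \<in> r" using lin sub \<xi>(1) by blast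
        ultimately show "\<exists>\<xi>\<in>preds r \<beta>. \<forall>c\<in>C. g \<beta> c = NaC \<or> g (Some \<xi>) c = g \<beta> c"
          by blast
      qed (rule IH)
    qed
  qed
  have "consistent (g (Some \<eta>))" if "\<eta> \<in> Field r" for \<eta>
    using that
  proof (induction \<eta> rule: wo_rel.well_order_induct[of r])
    case 1
    then show ?case using wo by (simp add: wo_rel_def)
  next
    case (2 \<eta>)
    show ?case
    proof (rule step)
      fix \<xi> assume "\<xi> \<in> preds r (Some \<eta>)"
      then have "\<xi> \<noteq> \<eta>" "(\<xi>, \<eta>) \<in> r" by (simp_all add: underS_def)
      then show "consistent (g (Some \<xi>))" using 2 by (blast intro: FieldI1)
    qed (use 2 in blast)
  qed
  then show ?thesis by (rule step[OF insertI1]) simp_all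
qed

section \<open>Permutation groups containing three-cycles\<close>

abbreviation three_cycle :: "'a \<Rightarrow> 'a \<Rightarrow> 'a \<Rightarrow> 'a \<Rightarrow> 'a" where
  "three_cycle x y z \<equiv> Transposition.transpose x y \<circ> Transposition.transpose y z"

lemma three_cycle_rotate:
  assumes "distinct [x, y, z]"
  shows "three_cycle x y z = three_cycle y z x"
  using assms by (auto simp: fun_eq_iff Transposition.transpose_def)

lemma inv_three_cycle: "inv (three_cycle x y z) = three_cycle z y x"
  by (rule inv_unique_comp) (simp_all add: fun_eq_iff transpose_commute)

lemma conj_three_cycle:
  assumes "bij p"
  shows "p \<circ> three_cycle x y z \<circ> inv p = three_cycle (p x) (p y) (p z)"
proof -
  have "p \<circ> Transposition.transpose a b = Transposition.transpose (p a) (p b) \<circ> p" for a b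
    using assms by (auto simp: fun_eq_iff Transposition.transpose_def bij_is_inj inj_eq)
  then have "p \<circ> three_cycle x y z = three_cycle (p x) (p y) (p z) \<circ> p"
    by (metis comp_assoc)
  moreover have "p \<circ> inv p = id" using assms by (simp add: surj_iff[symmetric] bij_is_surj)
  ultimately show ?thesis by (simp add: comp_assoc)
qed

lemma three_cycle_apply:
  assumes "distinct [x, y, z]"
  shows "three_cycle x y z x = y" "three_cycle x y z y = z" "three_cycle x y z z = x"
    "w \<noteq> x \<Longrightarrow> w \<noteq> y \<Longrightarrow> w \<noteq> z \<Longrightarrow> three_cycle x y z w = w"
  using assms by (auto simp: Transposition.transpose_def)

lemma three_cycle_permutes:
  "x \<in> X \<Longrightarrow> y \<in> X \<Longrightarrow> z \<in> X \<Longrightarrow> three_cycle x y z permutes X"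
  by (intro permutes_compose permutes_swap_id)

section \<open>Linked points and the even permutations\<close>

locale perm_group =
  fixes N :: "('a \<Rightarrow> 'a) set"
  assumes id_in: "id \<in> N"
    and comp_in: "p \<in> N \<Longrightarrow> q \<in> N \<Longrightarrow> p \<circ> q \<in> N"
    and inv_in: "p \<in> N \<Longrightarrow> inv p \<in> N"
    and bij_in: "p \<in> N \<Longrightarrow> bij p"
begin

definition tri :: "'a \<Rightarrow> 'a \<Rightarrow> 'a \<Rightarrow> bool" where
  "tri x y z \<longleftrightarrow> distinct [x, y, z] \<and> three_cycle x y z \<in> N"

lemma tri_rotate: "tri x y z \<Longrightarrow> tri y z x"
  by (metis tri_def three_cycle_rotate distinct_length_2_or_more distinct_singleton)

lemma tri_rev: "tri x y z \<Longrightarrow> tri z y x"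
  by (metis tri_def inv_three_cycle inv_in distinct_length_2_or_more distinct_singleton)

lemma tri_conj: "p \<in> N \<Longrightarrow> tri x y z \<Longrightarrow> tri (p x) (p y) (p z)"
proof -
  assume p: "p \<in> N" and t: "tri x y z"
  then have "p \<circ> three_cycle x y z \<circ> inv p \<in> N"
    by (auto simp: tri_def intro!: comp_in inv_in)
  then show ?thesis
    using t bij_in[OF p] by (simp add: conj_three_cycle tri_def bij_is_inj inj_eq)
qed

text \<open>Conjugating the cycle \<open>(x y w)\<close> by \<open>(x y z)\<close> gives
  \<open>(y z w)\<close>.\<close>

lemma tri_shift_common_pair:
  assumes "tri x y z" "tri x y w" "z \<noteq> w"
  shows "tri y z w"
  using tri_conj[OF _ assms(2), of "three_cycle x y z"] assms three_cycle_apply[of x y z]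
  unfolding tri_def by (metis distinct_length_2_or_more)

text \<open>Conjugating the cycle \<open>(x u v)\<close> by \<open>(x y z)\<close> replaces
  \<open>x\<close> by \<open>y\<close> and leaves \<open>u\<close> and \<open>v\<close>
  alone.\<close>

lemma tri_shift_common_point:
  assumes "tri x y z" "tri x u v" "distinct [y, z, u, v]"
  shows "tri y u v"
  using tri_conj[OF _ assms(2), of "three_cycle x y z"] assms three_cycle_apply[of x y z]
  unfolding tri_def by (metis distinct_length_2_or_more)

text \<open>This turns out to be an equivalence relation whose classes carry all their three-cycles,
  so connecting points by three-cycles suffices to obtain all even permutations.\<close>

definition linked :: "'a \<Rightarrow> 'a \<Rightarrow> bool" where
  "linked x y \<longleftrightarrow> x = y \<or> (\<exists>z. tri x y z)"

lemma linked_sym: "linked x y \<Longrightarrow> linked y x"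
  unfolding linked_def by (metis tri_rotate tri_rev)

text \<open>The two given cycles share \<open>y\<close>. Depending on which auxiliary points
  coincide, the two shift lemmas exchange \<open>u\<close> and \<open>v\<close> for the wanted
  points.\<close>

lemma tri_linked:
  assumes "linked x y" "linked y z" "distinct [x, y, z]"
  shows "tri x y z"
proof -
  obtain u v where u: "tri x y u" and v: "tri y z v"
    using assms by (auto simp: linked_def)
  consider "u = z" | "v = x" | "u = v" "u \<noteq> z" "v \<noteq> x" | "u \<noteq> v" "u \<noteq> z" "v \<noteq> x" by blast
  then show ?thesis
  proof cases
    case 1
    then show ?thesis using u by simp
  next
    case 2
    then show ?thesis using v tri_rotate by blast
  next
    case 3
    then have "tri u y x" "tri u y z" using u v by (meson tri_rotate tri_rev)+
    then have "tri y x z" by (rule tri_shift_common_pair) (use assms(3) in auto)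
    then show ?thesis by (rule tri_rotate[OF tri_rev])
  next
    case 4
    have "distinct [x, u, z, v]" using u v 4 assms(3) by (auto simp: tri_def)
    moreover have "tri y x u" using u by (meson tri_rotate tri_rev)
    ultimately have "tri x z v" using tri_shift_common_point v by blast
    then have "tri v z x" "tri v z y" using v by (meson tri_rotate tri_rev)+
    then have "tri z x y" by (rule tri_shift_common_pair) (use assms(3) in auto)
    then show ?thesis by (rule tri_rotate)
  qed
qed

lemma linked_trans: "linked x y \<Longrightarrow> linked y z \<Longrightarrow> linked x z"
proof (cases "distinct [x, y, z]")
  case True
  moreover assume "linked x y" "linked y z"
  ultimately have "tri x y z" using tri_linked by blast
  then show ?thesis unfolding linked_def using tri_rotate tri_rev by blast
qed (auto simp: linked_def)

context
  fixes X and x0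
  assumes linked_base: "x \<in> X \<Longrightarrow> linked x0 x"
begin

lemma tri_all:
  assumes "x \<in> X" "y \<in> X" "z \<in> X" "distinct [x, y, z]"
  shows "tri x y z"
proof -
  have "linked u v" if "u \<in> X" "v \<in> X" for u v
    using that by (metis linked_base linked_sym linked_trans)
  then show ?thesis using assms by (intro tri_linked) auto
qed

lemma two_transpositions_in:
  assumes "a \<in> X" "b \<in> X" "c \<in> X" "d \<in> X" "a \<noteq> b" "c \<noteq> d"
  shows "Transposition.transpose a b \<circ> Transposition.transpose c d \<in> N"
proof -
  have common: "Transposition.transpose x y \<circ> Transposition.transpose y z \<in> N"
    if "x \<in> X" "y \<in> X" "z \<in> X" "x \<noteq> y" "y \<noteq> z" for x y z
  proof (cases "x = z")
    case True
    then show ?thesis using id_in by (simp add: transpose_commute)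
  next
    case False
    then show ?thesis using tri_all that by (auto simp: tri_def)
  qed
  show ?thesis
  proof (cases "b = c")
    case True
    then show ?thesis using common assms by blast
  next
    case False
    \<comment> \<open>Inserting the transposition of \<open>b\<close> and \<open>c\<close> twice
      leaves two products of transpositions sharing a point.\<close>
    have "Transposition.transpose a b \<circ> Transposition.transpose c d =
      (Transposition.transpose a b \<circ> Transposition.transpose b c) \<circ>
      (Transposition.transpose b c \<circ> Transposition.transpose c d)"
      by (simp add: fun_eq_iff)
    then show ?thesis using common assms False by (metis comp_in)
  qed
qed

text \<open>This says without parity that \<open>N\<close> contains every even permutation of
  \<open>X\<close>: of \<open>p\<close> and its product with a fixed transposition, one is even. The
  induction adds one transposition at a time, and \<open>N\<close> absorbs products of two.\<close>

lemma permutes_in_or_odd: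
  assumes "finite X" "p permutes X" and uv: "u \<in> X" "v \<in> X" "u \<noteq> v"
  shows "p \<in> N \<or> Transposition.transpose u v \<circ> p \<in> N"
  using assms(2,1)
proof (induction p rule: permutes_induct)
  case id
  then show ?case using id_in by blast
next
  case (swap a b p)
  let ?t = "Transposition.transpose u v" and ?s = "Transposition.transpose a b"
  from swap.IH show ?case
  proof
    assume "p \<in> N"
    then have "(?t \<circ> ?s) \<circ> p \<in> N"
      using two_transpositions_in uv swap.hyps by (blast intro: comp_in)
    then show ?thesis by (simp only: comp_assoc simp_thms)
  next
    assume "?t \<circ> p \<in> N"
    then have "(?s \<circ> ?t) \<circ> (?t \<circ> p) \<in> N"
      using two_transpositions_in uv swap.hyps by (blast intro: comp_in)
    moreover have "(?s \<circ> ?t) \<circ> (?t \<circ> p) = ?s \<circ> p" by (simp add: fun_eq_iff)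
    ultimately show ?thesis by (simp only: simp_thms)
  qed
qed

end

end

section \<open>Solving all clusters of one level\<close>

lemma f_solved_face: "\<not> is_inf x \<Longrightarrow> \<not> is_inf y \<Longrightarrow> f_solved (x, y, PInf) = White"
  by (auto simp: f_solved_def)

text \<open>The clusters treated are those of \<open>(a, s, PInf)\<close> with \<open>s\<close> in
  \<open>R\<close>, and \<open>D\<close> holds the slices that may turn. \<open>admissible\<close>
  excludes the centres and repeated representatives, so that the clusters are disjoint and the
  rotations act freely on each.\<close>

locale orbit_family =
  fixes a :: "'l coord" and R D :: "'l coord set"
  assumes D_neg: "neg \<alpha> \<in> D \<longleftrightarrow> \<alpha> \<in> D"
    and a_D: "a \<in> D" and R_D: "R \<subseteq> D" and PInf_D: "PInf \<in> D"
    and admissible: "a = Zero \<and> R \<subseteq> range Pos \<or>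
      a \<in> range Pos \<and> (\<forall>s\<in>R. \<not> is_inf s \<and> s \<noteq> Zero \<and> s \<noteq> a)"
begin

abbreviation pt :: "'l coord \<Rightarrow> 'l point" where
  "pt s \<equiv> (a, s, PInf)"

lemma a_finite: "\<not> is_inf a" and R_finite: "s \<in> R \<Longrightarrow> \<not> is_inf s"
  and R_a: "s \<in> R \<Longrightarrow> s \<noteq> a"
  using admissible by auto

lemma neg_R: "s \<in> R \<Longrightarrow> a = Zero \<Longrightarrow> neg s \<notin> R"
proof
  assume "s \<in> R" "a = Zero" "neg s \<in> R"
  moreover from this have "R \<subseteq> range Pos" using admissible by auto
  ultimately have "s \<in> range Pos" "neg s \<in> range Pos" by blast+
  then show False by auto
qed

lemma rots_pt_eq_pt:
  assumes "\<rho> \<in> rots" "s \<in> R" "s' \<in> R" "\<rho> (pt s) = pt s'"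
  shows "\<rho> = id" "s' = s"
proof -
  have s: "s \<noteq> PInf" "s \<noteq> NInf" "s \<noteq> a" "s' \<noteq> a" "a \<noteq> PInf" "a \<noteq> NInf"
    "a = Zero \<Longrightarrow> s' \<noteq> neg s"
    using assms R_finite R_a a_finite neg_R by (auto simp: is_inf_def)
  have "\<rho> = (\<lambda>p. (prj AX p, prj AY p, prj AZ p))"
    using rots_explicit[OF assms(1)] assms(4) s
    unfolding Let_def insert_iff empty_iff
    by (elim disjE) auto
  then show "\<rho> = id" by (auto simp: fun_eq_iff)
  then show "s' = s" using assms(4) by simp
qed

text \<open>Hence a rotation together with \<open>s\<close> is an unambiguous name of a cell.
  Applying the inverse of one rotation reduces the claim to \<open>rots_pt_eq_pt\<close>.\<close>

lemma rots_pt_inj: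
  assumes "\<rho> \<in> rots" "\<rho>' \<in> rots" "s \<in> R" "s' \<in> R" "\<rho> (pt s) = \<rho>' (pt s')"
  shows "\<rho> = \<rho>'" "s = s'"
proof -
  have b: "bij \<rho>'" using assms rots_bij by blast
  have "inv \<rho>' \<circ> \<rho> \<in> rots" using assms rots_inv rots_comp by blast
  moreover have "(inv \<rho>' \<circ> \<rho>) (pt s) = pt s'"
    using assms(5) b by (simp add: bij_is_inj)
  ultimately have *: "inv \<rho>' \<circ> \<rho> = id" "s' = s"
    using rots_pt_eq_pt assms by blast+
  have "\<rho> = \<rho>' \<circ> (inv \<rho>' \<circ> \<rho>)"
    using b by (metis bij_is_surj comp_assoc id_comp surj_iff)
  then show "\<rho> = \<rho>'" "s = s'" using * by simp_all
qed

section \<open>Moves coded by permutations of the rotation group\<close>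

definition outside :: "'l point \<Rightarrow> bool" where
  "outside p \<longleftrightarrow> (\<forall>\<rho>\<in>rots. \<forall>s\<in>R. p \<noteq> \<rho> (pt s))"

text \<open>The cells of all clusters share one finite stock of names, the rotations, and
  \<open>\<pi> s\<close> permutes the names within the cluster of \<open>s\<close>. The choice by
  \<open>SOME\<close> is unambiguous by \<open>rots_pt_inj\<close>.\<close>

definition lift :: "('l coord \<Rightarrow> ('l point \<Rightarrow> 'l point) \<Rightarrow> 'l point \<Rightarrow> 'l point) \<Rightarrow> 'l point \<Rightarrow> 'l point" where
  "lift \<pi> p = (if outside p then p else
     (let (\<rho>, s) = (SOME (\<rho>, s). \<rho> \<in> rots \<and> s \<in> R \<and> p = \<rho> (pt s)) in \<pi> s \<rho> (pt s)))"

lemma lift_outside: "outside p \<Longrightarrow> lift \<pi> p = p"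
  by (simp add: lift_def)

lemma lift_pt:
  assumes "\<rho> \<in> rots" "s \<in> R"
  shows "lift \<pi> (\<rho> (pt s)) = \<pi> s \<rho> (pt s)"
proof -
  have "(SOME (\<rho>', s'). \<rho>' \<in> rots \<and> s' \<in> R \<and> \<rho> (pt s) = \<rho>' (pt s')) = (\<rho>, s)"
  proof (rule some_equality)
    fix x assume x: "case x of (\<rho>', s') \<Rightarrow> \<rho>' \<in> rots \<and> s' \<in> R \<and> \<rho> (pt s) = \<rho>' (pt s')"
    obtain \<rho>' s' where "x = (\<rho>', s')" by fastforce
    then show "x = (\<rho>, s)"
      using x rots_pt_inj[OF assms(1) _ assms(2), of \<rho>' s'] by (simp only: prod.case)
  qed (use assms in simp)
  then show ?thesis using assms by (auto simp: lift_def outside_def)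
qed

lemma point_cases:
  obtains "outside p" | \<rho> s where "\<rho> \<in> rots" "s \<in> R" "p = \<rho> (pt s)"
  unfolding outside_def by blast

lemma lift_comp:
  assumes "\<And>s. s \<in> R \<Longrightarrow> \<pi>' s permutes rots"
  shows "lift \<pi> \<circ> lift \<pi>' = lift (\<lambda>s. \<pi> s \<circ> \<pi>' s)"
proof
  fix p
  show "(lift \<pi> \<circ> lift \<pi>') p = lift (\<lambda>s. \<pi> s \<circ> \<pi>' s) p"
  proof (cases p rule: point_cases)
    case (2 \<rho> s)
    moreover have "\<pi>' s \<rho> \<in> rots" using assms 2 by (simp add: permutes_in_image)
    ultimately show ?thesis by (simp only: o_apply lift_pt)
  qed (simp add: lift_outside)
qed

lemma lift_cong: "(\<And>s. s \<in> R \<Longrightarrow> \<pi> s = \<pi>' s) \<Longrightarrow> lift \<pi> = lift \<pi>'"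
proof
  fix p
  assume "\<And>s. s \<in> R \<Longrightarrow> \<pi> s = \<pi>' s"
  then show "lift \<pi> p = lift \<pi>' p"
    by (cases p rule: point_cases) (simp_all only: lift_outside lift_pt)
qed

lemma lift_id: "lift (\<lambda>s. id) = id"
proof
  fix p
  show "lift (\<lambda>s. id) p = id p"
    by (cases p rule: point_cases) (simp_all only: lift_outside lift_pt id_apply)
qed

lemma outside_rots: "\<rho> \<in> rots \<Longrightarrow> outside p \<Longrightarrow> outside (\<rho> p)"
proof -
  assume \<rho>: "\<rho> \<in> rots" and o: "outside p"
  have False if "\<rho>' \<in> rots" "s \<in> R" "\<rho> p = \<rho>' (pt s)" for \<rho>' s
  proof -
    have "p = (inv \<rho> \<circ> \<rho>') (pt s)"
      using that(3) rots_bij[OF \<rho>] by (metis bij_is_inj comp_apply inv_f_f)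
    then show False using o that \<rho> rots_inv rots_comp unfolding outside_def by blast
  qed
  then show ?thesis unfolding outside_def by blast
qed

text \<open>On names, a rotation of the whole cube acts by left multiplication.\<close>

lemma lift_conj:
  assumes \<rho>: "\<rho> \<in> rots" and \<pi>: "\<And>s. s \<in> R \<Longrightarrow> \<pi> s permutes rots"
  shows "\<rho> \<circ> lift \<pi> \<circ> inv \<rho> = lift (\<lambda>s \<tau>. \<rho> \<circ> \<pi> s (inv \<rho> \<circ> \<tau>))"
proof
  fix p
  have b: "\<rho> (inv \<rho> q) = q" for q using rots_bij[OF \<rho>] by (metis bij_is_surj surj_f_inv_f)
  show "(\<rho> \<circ> lift \<pi> \<circ> inv \<rho>) p = lift (\<lambda>s \<tau>. \<rho> \<circ> \<pi> s (inv \<rho> \<circ> \<tau>)) p"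
  proof (cases p rule: point_cases)
    case 1
    then have "outside (inv \<rho> p)" using \<rho> rots_inv outside_rots by blast
    then show ?thesis using 1 b by (simp only: o_apply lift_outside)
  next
    case (2 \<tau> s)
    have "inv \<rho> \<circ> \<tau> \<in> rots" using 2 \<rho> rots_inv rots_comp by blast
    from lift_pt[OF this 2(2), of \<pi>] show ?thesis
      using 2 by (simp only: o_apply lift_pt)
  qed
qed

text \<open>Quantifying over \<open>Z\<close> demands that the permutation can be performed on any
  collection of clusters while all others stay fixed. This lets different clusters receive different
  permutations in \<open>lift_family\<close>.\<close>

definition liftable :: "(('l point \<Rightarrow> 'l point) \<Rightarrow> 'l point \<Rightarrow> 'l point) set" where
  "liftable = {\<pi>. \<pi> permutes rots \<and> (\<forall>Z\<subseteq>R. lift (\<lambda>s. if s \<in> Z then \<pi> else id) \<in> moves D)}"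

lemma permutes_if: "\<pi> permutes rots \<Longrightarrow> (if s \<in> Z then \<pi> else id) permutes rots"
  by (simp add: permutes_id)

lemma perm_group_liftable: "perm_group liftable"
proof
  show "id \<in> liftable" using lift_id moves_id by (auto simp: liftable_def permutes_id if_distrib)
next
  fix p q assume pq: "p \<in> liftable" "q \<in> liftable"
  have "lift (\<lambda>s. if s \<in> Z then p \<circ> q else id) \<in> moves D" if "Z \<subseteq> R" for Z
  proof -
    have "lift (\<lambda>s. if s \<in> Z then p \<circ> q else id) =
        lift (\<lambda>s. if s \<in> Z then p else id) \<circ> lift (\<lambda>s. if s \<in> Z then q else id)"
      using pq by (subst lift_comp) (auto simp: liftable_def permutes_if intro!: lift_cong)
    then show ?thesis using pq that by (simp add: liftable_def moves_comp)
  qed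
  then show "p \<circ> q \<in> liftable" using pq by (simp add: liftable_def permutes_compose)
next
  fix p assume p: "p \<in> liftable"
  then have perm: "p permutes rots" by (simp add: liftable_def)
  then have "bij p" by (rule permutes_bij)
  have "lift (\<lambda>s. if s \<in> Z then inv p else id) \<in> moves D" if "Z \<subseteq> R" for Z
  proof -
    let ?f = "\<lambda>p s. if s \<in> Z then p else id"
    have 1: "lift (?f p) \<circ> lift (?f (inv p)) = lift (\<lambda>s. ?f p s \<circ> ?f (inv p) s)"
      using perm by (intro lift_comp permutes_if permutes_inv)
    have 2: "lift (?f (inv p)) \<circ> lift (?f p) = lift (\<lambda>s. ?f (inv p) s \<circ> ?f p s)"
      using perm by (intro lift_comp permutes_if)
    have "(\<lambda>s. ?f p s \<circ> ?f (inv p) s) = (\<lambda>s. id)" "(\<lambda>s. ?f (inv p) s \<circ> ?f p s) = (\<lambda>s. id)"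
      using permutes_inv_o[OF perm] by auto
    then have "inv (lift (?f p)) = lift (?f (inv p))"
      using 1 2 lift_id by (intro inv_unique_comp) simp_all
    then show ?thesis using p that moves_inv[of "lift (?f p)" D] by (simp add: liftable_def)
  qed
  then show "inv p \<in> liftable" using perm by (simp add: liftable_def permutes_inv)
  show "bij p" by fact
qed

sublocale perm_group liftable
  by (rule perm_group_liftable)

text \<open>In a slice \<open>y = s\<close> turned by \<open>q\<close>, the commutator
  \<open>g\<close> moves only the cell \<open>pt s\<close>. As the two overlap in one cell per
  slice, their commutator is a three-cycle for each \<open>s\<close> in \<open>Z\<close>; in names
  it runs through \<open>id\<close>, \<open>rot AX\<close>, \<open>rot AY\<close>.\<close>

lemma lift_three_cycle_in_moves:
  assumes "Z \<subseteq> R"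
  shows "lift (\<lambda>s. if s \<in> Z then three_cycle id (rot AX) (rot AY) else id) \<in> moves D"
proof -
  let ?c = "lift (\<lambda>s. if s \<in> Z then three_cycle id (rot AX) (rot AY) else id)"
  define A B q :: "'l point \<Rightarrow> 'l point" where "A = slice AX (\<lambda>\<alpha>. if \<alpha> = a then 1 else 0)"
    and "B = slice AZ (\<lambda>\<alpha>. if \<alpha> = PInf then 1 else 0)"
    and "q = slice AY (\<lambda>\<alpha>. if \<alpha> \<in> Z then 1 else 0)"
  define g where "g = A \<circ> B \<circ> inv A \<circ> inv B"
  have AB: "A \<in> moves D" "B \<in> moves D" "q \<in> moves D"
    unfolding A_def B_def q_def using a_D PInf_D R_D assms by (auto intro!: slice_in_moves)
  have g: "g \<in> moves D" unfolding g_def using AB by (intro moves_comp moves_inv)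
  have Z: "y \<noteq> PInf" "y \<noteq> NInf" "y \<noteq> a" "y \<in> R" if "y \<in> Z" for y
    using that assms R_finite R_a by (auto simp: is_inf_def)
  have a: "a \<noteq> PInf" "a \<noteq> NInf" using a_finite by (auto simp: is_inf_def)
  \<comment> \<open>For a cell of the top face, \<open>inv B\<close> moves \<open>y\<close> to the
    first place; as \<open>y\<close> differs from \<open>a\<close>, \<open>inv A\<close> does
    nothing and \<open>B\<close> undoes \<open>inv B\<close>. For other cells, \<open>inv A\<close>
    does not lead into the top face since \<open>y\<close> is finite, so \<open>A\<close> undoes
    it.\<close>
  have g_fix: "g (x, y, z) = (x, y, z)" if "y \<in> Z" "\<not> (x = a \<and> z = PInf)" for x y z
    using Z[OF that(1)] that(2) a
    by (auto simp: g_def A_def B_def inv_slice slice_def numeral_eq_Suc)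
  have g_pt: "g (pt s) = rot AX (pt s)" if "s \<in> Z" for s
    using Z[OF that] a
    by (auto simp: g_def A_def B_def inv_slice slice_def numeral_eq_Suc)
  have q: "q p = (if prj AY p \<in> Z then rot AY p else p)" for p
    by (auto simp: q_def slice_def)
  have d: "id \<noteq> (rot AX :: 'l point \<Rightarrow> _)" "id \<noteq> (rot AY :: 'l point \<Rightarrow> _)"
    "(rot AX :: 'l point \<Rightarrow> _) \<noteq> rot AY"
    by (auto simp: fun_eq_iff intro!: exI[of _ Zero] exI[of _ PInf])
  have c: "?c (pt s) = rot AX (pt s)" "?c (rot AX (pt s)) = rot AY (pt s)" "?c (rot AY (pt s)) = pt s"
    if "s \<in> Z" for s
    using lift_pt[OF rots_id] lift_pt[OF rot_in_rots] Z(4)[OF that] d that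
    by (simp_all del: rot.simps add: three_cycle_apply)
  have c_fix: "?c p = p" if "\<And>s. s \<in> Z \<Longrightarrow> p \<noteq> pt s \<and> p \<noteq> rot AX (pt s) \<and> p \<noteq> rot AY (pt s)" for p
  proof (cases p rule: point_cases)
    case (2 \<rho> s)
    have "\<rho> \<noteq> id \<and> \<rho> \<noteq> rot AX \<and> \<rho> \<noteq> rot AY" if "s \<in> Z"
      using \<open>s \<in> Z \<Longrightarrow> p \<noteq> pt s \<and> p \<noteq> rot AX (pt s) \<and> p \<noteq> rot AY (pt s)\<close>[OF that] 2(3)
      by (metis id_apply)
    then have "(if s \<in> Z then three_cycle id (rot AX) (rot AY) else id) \<rho> = \<rho>"
      by (simp add: transpose_apply_other)
    then show ?thesis using 2 lift_pt by simp
  qed (simp add: lift_outside)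
  have inj_g: "g x = g y \<longleftrightarrow> x = y" for x y using moves_bij[OF g] by (simp add: bij_is_inj inj_eq)
  \<comment> \<open>The commutator identity is checked pointwise in a form free of inverses. Inside
    the slices of \<open>Z\<close> only cells with \<open>p\<close> or \<open>q p\<close> equal to
    \<open>pt y\<close> matter; outside, only those that \<open>g\<close> brings into such a
    slice.\<close>
  have "g (q p) = ?c (q (g p))" for p
  proof (cases "prj AY p \<in> Z")
    case True
    obtain x y z where p: "p = (x, y, z)" by (cases p)
    with True have y: "y \<in> Z" by simp
    have qp: "q p = (z, y, neg x)" using y by (simp add: q p)
    consider "p = pt y" | "q p = pt y" | "p \<noteq> pt y" "q p \<noteq> pt y" by blast
    then show ?thesis
    proof cases
      case 1
      then have "g (q p) = q p" using qp y a g_fix[of y] p by auto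
      moreover have "q (g p) = rot AX (pt y)" using 1 g_pt[OF y] Z[of NInf] by (auto simp: q)
      moreover have "q p = rot AY (pt y)" using 1 qp p by auto
      ultimately show ?thesis using c y by simp
    next
      case 2
      then have "g p = p" using qp y a g_fix[of y] p by auto
      then show ?thesis using 2 g_pt c y by simp
    next
      case 3
      have "g p = p" using 3(1) g_fix y unfolding p by auto
      moreover have "g (q p) = q p" using 3(2) g_fix y unfolding qp by auto
      moreover have "?c (q p) = q p"
      proof (rule c_fix)
        fix s assume "s \<in> Z"
        then show "q p \<noteq> pt s \<and> q p \<noteq> rot AX (pt s) \<and> q p \<noteq> rot AY (pt s)"
          using 3 y Z p unfolding qp by auto
      qed
      ultimately show ?thesis by simp
    qed
  next
    case False
    then have qp: "q p = p" by (simp add: q)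
    show ?thesis
    proof (cases "prj AY (g p) \<in> Z")
      case True
      obtain x y z where gp: "g p = (x, y, z)" by (cases "g p")
      with True have y: "y \<in> Z" by simp
      \<comment> \<open>Every other cell of the slice is fixed by the injective \<open>g\<close>, so
        it cannot be reached from outside.\<close>
      have "g p = pt y"
      proof (rule ccontr)
        assume "g p \<noteq> pt y"
        then have "g (g p) = g p" using g_fix y unfolding gp by blast
        then show False using True False by (simp add: inj_g)
      qed
      then show ?thesis using qp y c by (simp add: q del: rot.simps)
    next
      case F: False
      have "g p \<noteq> rot AX (pt s)" if "s \<in> Z" for s
        using g_pt[OF that] False that by (metis inj_g prj.simps(2))
      then have "?c (g p) = g p" using F by (intro c_fix) auto
      then show ?thesis using F qp by (simp add: q)
    qed
  qed
  then have "g \<circ> q = ?c \<circ> (q \<circ> g)" by (simp add: fun_eq_iff del: split_paired_All)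
  then have "(g \<circ> q) \<circ> inv (q \<circ> g) = ?c \<circ> ((q \<circ> g) \<circ> inv (q \<circ> g))"
    by (simp only: comp_assoc)
  moreover have "(q \<circ> g) \<circ> inv (q \<circ> g) = id"
    using moves_bij[OF moves_comp[OF AB(3) g]] by (simp only: bij_is_surj flip: surj_iff)
  ultimately have "?c = (g \<circ> q) \<circ> inv (q \<circ> g)"
    by (simp only: comp_id)
  then show ?thesis using AB g by (simp only: moves_comp moves_inv)
qed

text \<open>Conjugating the basic cycle by a rotation of the cube multiplies its three names by
  \<open>\<rho>\<close> on the left, and \<open>moves_conj\<close> keeps the result among the moves
  of \<open>D\<close>.\<close>

lemma tri_base:
  assumes \<rho>: "\<rho> \<in> rots"
  shows "tri \<rho> (\<rho> \<circ> rot AX) (\<rho> \<circ> rot AY)"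
proof -
  let ?t = "three_cycle id (rot AX) (rot AY)" and ?t' = "three_cycle \<rho> (\<rho> \<circ> rot AX) (\<rho> \<circ> rot AY)"
  have \<rho>': "\<rho> \<circ> inv \<rho> = id" "inv \<rho> \<circ> \<rho> = id"
    using rots_bij[OF \<rho>] by (simp_all add: surj_iff[symmetric] bij_is_surj bij_is_inj)
  then have bL: "bij ((\<circ>) \<rho>)" and iL: "inv ((\<circ>) \<rho>) = (\<circ>) (inv \<rho>)"
    by (intro o_bij[where g = "(\<circ>) (inv \<rho>)"] inv_unique_comp; simp add: fun_eq_iff del: split_paired_All)+
  have conj: "?t' \<tau> = \<rho> \<circ> ?t (inv \<rho> \<circ> \<tau>)" for \<tau>
    using conj_three_cycle[OF bL, of id "rot AX" "rot AY"] unfolding iL by (metis comp_apply comp_id)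
  have t: "?t permutes rots" by (intro three_cycle_permutes rots_id rot_in_rots)
  have "?t' \<in> liftable"
    unfolding liftable_def
  proof (intro CollectI conjI allI impI)
    show "?t' permutes rots" by (intro three_cycle_permutes \<rho> rots_comp rot_in_rots)
    fix Z assume Z: "Z \<subseteq> R"
    have "lift (\<lambda>s. if s \<in> Z then ?t' else id) = \<rho> \<circ> lift (\<lambda>s. if s \<in> Z then ?t else id) \<circ> inv \<rho>"
      unfolding lift_conj[OF \<rho> permutes_if[OF t]]
    proof (rule lift_cong, rule ext)
      fix s and \<tau> :: "'l point \<Rightarrow> 'l point"
      have "\<rho> \<circ> (inv \<rho> \<circ> \<tau>) = \<tau>" using \<rho>'(1) by (metis comp_assoc id_comp)
      then show "(if s \<in> Z then ?t' else id) \<tau> = \<rho> \<circ> (if s \<in> Z then ?t else id) (inv \<rho> \<circ> \<tau>)"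
        using conj by simp
    qed
    then show "lift (\<lambda>s. if s \<in> Z then ?t' else id) \<in> moves D"
      using moves_conj[OF D_neg \<rho> lift_three_cycle_in_moves[OF Z]] by simp
  qed
  moreover have "distinct [\<rho>, \<rho> \<circ> rot AX, \<rho> \<circ> rot AY]"
  proof -
    have i: "\<rho> x = \<rho> y \<longleftrightarrow> x = y" for x y using rots_bij[OF \<rho>] by (simp add: bij_is_inj inj_eq)
    have "\<rho> (Zero, Zero, PInf) \<noteq> \<rho> (rot AX (Zero, Zero, PInf))"
      "\<rho> (Zero, Zero, PInf) \<noteq> \<rho> (rot AY (Zero, Zero, PInf))"
      "\<rho> (rot AX (Zero, Zero, PInf)) \<noteq> \<rho> (rot AY (Zero, Zero, PInf))"
      unfolding i by simp_all
    then show ?thesis by (metis comp_apply distinct_length_2_or_more distinct_singleton)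
  qed
  ultimately show ?thesis by (simp add: tri_def)
qed

text \<open>The generating steps of \<open>rots\<close> are right multiplications by
  \<open>rot AX\<close> and \<open>rot AY\<close>, exactly the links supplied by
  \<open>tri_base\<close>.\<close>

lemma linked_rots: "\<rho> \<in> rots \<Longrightarrow> linked id \<rho>"
proof (induction rule: rots.induct)
  case (rots_X \<rho>)
  moreover have "linked \<rho> (\<rho> \<circ> rot AX)" using tri_base[OF rots_X(1)] by (auto simp: linked_def)
  ultimately show ?case using linked_trans by blast
next
  case (rots_Y \<rho>)
  moreover have "linked \<rho> (\<rho> \<circ> rot AY)"
    using tri_base[OF rots_Y(1)] tri_rotate unfolding linked_def by (metis tri_rev)
  ultimately show ?case using linked_trans by blast
qed (simp add: linked_def)

text \<open>Equal colour counts give some permutation of the names that sorts the colours; up to one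
  transposition it is liftable.\<close>

lemma solve_orbit:
  assumes s: "s \<in> R"
    and eq: "image_mset h (mset_set (orb (pt s))) = image_mset f_solved (mset_set (orb (pt s)))"
  shows "\<exists>\<pi>\<in>liftable. \<forall>\<rho>\<in>rots. h (\<rho> (pt s)) = f_solved (\<pi> \<rho> (pt s))"
proof -
  have inj: "inj_on (\<lambda>\<rho>. \<rho> (pt s)) rots"
    using rots_pt_inj s by (intro inj_onI) blast
  have "image_mset k (mset_set (orb (pt s))) = image_mset (\<lambda>\<rho>. k (\<rho> (pt s))) (mset_set rots)" for k :: "'l point \<Rightarrow> color"
    unfolding orb_def image_mset_mset_set[OF inj, symmetric] by (simp add: multiset.map_comp comp_def)
  then obtain p where p: "p permutes rots" "\<forall>\<rho>\<in>rots. h (\<rho> (pt s)) = f_solved (p \<rho> (pt s))"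
    using image_mset_eq_implies_permutes[OF finite_rots, of "\<lambda>\<rho>. h (\<rho> (pt s))" "\<lambda>\<rho>. f_solved (\<rho> (pt s))"] eq
    by metis
  let ?t = "Transposition.transpose id (rot AZ)"
  have nz: "id \<noteq> (rot AZ :: 'l point \<Rightarrow> _)"
    by (auto simp: fun_eq_iff intro!: exI[of _ Zero] exI[of _ PInf])
  \<comment> \<open>A quarter turn of the face keeps the colour, so this transposition repairs the parity for free.\<close>
  have t: "f_solved (?t \<rho> (pt s)) = f_solved (\<rho> (pt s))" for \<rho>
    using R_finite[OF s] a_finite by (auto simp: Transposition.transpose_def f_solved_face)
  from permutes_in_or_odd[OF linked_rots finite_rots p(1) rots_id rot_in_rots nz]
  show ?thesis
  proof
    assume "p \<in> liftable"
    then show ?thesis using p by blast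
  next
    assume "?t \<circ> p \<in> liftable"
    moreover have "\<forall>\<rho>\<in>rots. h (\<rho> (pt s)) = f_solved ((?t \<circ> p) \<rho> (pt s))"
      using p(2) t by (simp only: o_apply)
    ultimately show ?thesis by blast
  qed
qed

text \<open>\<open>R\<close> may be infinite, but the names have only finitely many permutations.
  Clusters assigned the same \<open>\<phi>\<close> are treated together, so finitely many moves
  suffice.\<close>

lemma lift_family:
  assumes "\<And>s. s \<in> R \<Longrightarrow> \<pi> s \<in> liftable"
  shows "lift \<pi> \<in> moves D"
proof -
  have perm: "\<pi> s permutes rots" if "s \<in> R" for s using assms that by (simp add: liftable_def)
  have "lift (\<lambda>s. if \<pi> s \<in> F then \<pi> s else id) \<in> moves D" if "finite F" for F
    using that
  proof (induction F rule: finite_induct)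
    case empty
    show ?case by (simp only: lift_id moves_id empty_iff if_False)
  next
    case (insert \<phi> F)
    let ?Z = "{s \<in> R. \<pi> s = \<phi>}"
    let ?f = "\<lambda>s. if s \<in> ?Z then \<phi> else id" and ?g = "\<lambda>s. if \<pi> s \<in> F then \<pi> s else id"
    have "lift (\<lambda>s. if \<pi> s \<in> insert \<phi> F then \<pi> s else id) = lift (\<lambda>s. ?f s \<circ> ?g s)"
      using insert(2) by (intro lift_cong) auto
    also have "\<dots> = lift ?f \<circ> lift ?g"
      by (rule lift_comp[symmetric]) (simp add: perm permutes_id)
    finally have eq: "lift (\<lambda>s. if \<pi> s \<in> insert \<phi> F then \<pi> s else id) = lift ?f \<circ> lift ?g" .
    have "lift ?f \<in> moves D"
    \<comment> \<open>If no cluster is assigned \<open>\<phi>\<close>, it need not be liftable, but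
      then there is nothing to move.\<close>
    proof (cases "?Z = {}")
      case True
      then have "lift ?f = lift (\<lambda>s. id)" by (intro lift_cong) auto
      then show ?thesis by (simp only: lift_id moves_id)
    next
      case False
      then have "\<phi> \<in> liftable" using assms by blast
      then have "\<forall>Z\<subseteq>R. lift (\<lambda>s. if s \<in> Z then \<phi> else id) \<in> moves D"
        unfolding liftable_def by blast
      then show ?thesis by (rule allE[of _ ?Z]) blast
    qed
    then show ?case using eq insert.IH by (simp only: moves_comp)
  qed
  from this[of "{p. p permutes rots}"] have "lift (\<lambda>s. if \<pi> s permutes rots then \<pi> s else id) \<in> moves D"
    by (simp add: finite_permutations)
  moreover have "lift (\<lambda>s. if \<pi> s permutes rots then \<pi> s else id) = lift \<pi>"
    by (rule lift_cong) (simp add: perm)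
  ultimately show ?thesis by simp
qed

lemma solve_orbits:
  assumes "\<And>q. is_cell q \<Longrightarrow> image_mset h (mset_set (orb q)) = image_mset f_solved (mset_set (orb q))"
  shows "\<exists>m\<in>moves D. (\<forall>s\<in>R. \<forall>p\<in>orb (pt s). h (inv m p) = f_solved p) \<and>
    (\<forall>p. (\<forall>s\<in>R. p \<notin> orb (pt s)) \<longrightarrow> inv m p = p)"
proof -
  have cell: "is_cell (pt s)" if "s \<in> R" for s
    using a_finite R_finite[OF that] by (simp add: is_cell_def)
  have "\<forall>s\<in>R. \<exists>\<pi>\<in>liftable. \<forall>\<rho>\<in>rots. h (\<rho> (pt s)) = f_solved (\<pi> \<rho> (pt s))"
    using solve_orbit assms cell by blast
  then obtain \<pi> where \<pi>: "\<And>s. s \<in> R \<Longrightarrow> \<pi> s \<in> liftable"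
    "\<And>s \<rho>. s \<in> R \<Longrightarrow> \<rho> \<in> rots \<Longrightarrow> h (\<rho> (pt s)) = f_solved (\<pi> s \<rho> (pt s))"
    by metis
  let ?m = "lift \<pi>"
  have m: "?m \<in> moves D" using lift_family \<pi>(1) by blast
  have inv_m: "inv ?m p = p'" if "?m p' = p" for p p'
    using moves_bij[OF m] that by (metis bij_is_inj inv_f_f)
  have "h (inv ?m (\<rho> (pt s))) = f_solved (\<rho> (pt s))" if "s \<in> R" and \<rho>: "\<rho> \<in> rots" for s \<rho>
  proof -
    have perm: "\<pi> s permutes rots" using \<pi>(1) that by (simp add: liftable_def)
    then obtain \<rho>' where \<rho>': "\<rho>' \<in> rots" "\<pi> s \<rho>' = \<rho>"
      using \<rho> by (metis imageE permutes_image)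
    then have "inv ?m (\<rho> (pt s)) = \<rho>' (pt s)"
      using that by (intro inv_m) (simp add: lift_pt)
    then show ?thesis using \<pi>(2) \<rho>' that by simp
  qed
  moreover have "inv ?m p = p" if "\<forall>s\<in>R. p \<notin> orb (pt s)" for p
    using that by (intro inv_m lift_outside) (auto simp: outside_def orb_def)
  ultimately show ?thesis using m by (intro bexI[of _ ?m]) (auto simp: orb_def)
qed

end

section \<open>Levels\<close>

lemma act_slice: "act (slice i e) h p = h (slice i (\<lambda>\<alpha>. 3 * e \<alpha>) p)"
  by (simp add: act_def inv_slice)

lemma orb_sym: "p \<in> orb q \<Longrightarrow> q \<in> orb p"
proof -
  assume "p \<in> orb q"
  then obtain \<rho> where \<rho>: "\<rho> \<in> rots" "p = \<rho> q" by (auto simp: orb_def)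
  then have "q = inv \<rho> p" using rots_bij by (metis bij_is_inj inv_f_f)
  then show ?thesis using \<rho> rots_inv unfolding orb_def by blast
qed

lemma orb_trans: "p \<in> orb q \<Longrightarrow> q \<in> orb r \<Longrightarrow> p \<in> orb r"
  by (metis (no_types, lifting) imageE orb_def orb_rots)

lemma orb_rot: "rot i p \<in> orb q \<Longrightarrow> p \<in> orb q"
  using orb_rots[OF rot_in_rots orb_refl] orb_sym orb_trans by metis

lemma cell_orb_top:
  assumes "is_cell c"
  obtains \<alpha> \<beta> where "\<not> is_inf \<alpha>" "\<not> is_inf \<beta>" "c \<in> orb (\<alpha>, \<beta>, PInf)"
proof -
  obtain x y z where c: "c = (x, y, z)" by (cases c)
  consider "x = PInf" "\<not> is_inf y" "\<not> is_inf z" | "x = NInf" "\<not> is_inf y" "\<not> is_inf z"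
    | "y = PInf" "\<not> is_inf x" "\<not> is_inf z" | "y = NInf" "\<not> is_inf x" "\<not> is_inf z"
    | "z = PInf" "\<not> is_inf x" "\<not> is_inf y" | "z = NInf" "\<not> is_inf x" "\<not> is_inf y"
    using assms by (auto simp: c is_cell_def is_inf_def)
  then show thesis
  proof cases
    case 1
    then have "rot AY (rot AY (rot AY c)) = (neg z, y, PInf)" by (simp add: c)
    then show thesis using 1 that[of "neg z" y] orb_rot orb_refl by (metis is_inf_simps(6))
  next
    case 2
    then have "rot AY c = (z, y, PInf)" by (simp add: c)
    then show thesis using 2 that[of z y] orb_rot orb_refl by metis
  next
    case 3
    then have "rot AX c = (x, neg z, PInf)" by (simp add: c)
    then show thesis using 3 that[of x "neg z"] orb_rot orb_refl by (metis is_inf_simps(6))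
  next
    case 4
    then have "rot AX (rot AX (rot AX c)) = (x, z, PInf)" by (simp add: c)
    then show thesis using 4 that[of x z] orb_rot orb_refl by metis
  next
    case 5
    then show thesis using that[of x y] c by simp
  next
    case 6
    then have "rot AX (rot AX c) = (x, neg y, PInf)" by (simp add: c)
    then show thesis using 6 that[of x "neg y"] orb_rot orb_refl by (metis is_inf_simps(6))
  qed
qed

section \<open>Colour counts in clusters\<close>

definition balanced :: "'l conf \<Rightarrow> bool" where
  "balanced h \<longleftrightarrow>
     (\<forall>q. is_cell q \<longrightarrow> image_mset h (mset_set (orb q)) = image_mset f_solved (mset_set (orb q)))"

lemma balanced_moves:
  assumes "balanced h" "m \<in> moves D"
  shows "balanced (h \<circ> inv m)"
  unfolding balanced_def
proof (intro allI impI)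
  fix q :: "'a point" assume q: "is_cell q"
  have "bij_betw (inv m) (orb q) (orb q)"
    using bij_betw_moves_orb moves_inv assms(2) by blast
  then have "image_mset (inv m) (mset_set (orb q)) = mset_set (orb q)"
    by (metis bij_betw_def image_mset_mset_set)
  then have "image_mset (h \<circ> inv m) (mset_set (orb q)) = image_mset h (mset_set (orb q))"
    by (metis multiset.map_comp)
  then show "image_mset (h \<circ> inv m) (mset_set (orb q)) = image_mset f_solved (mset_set (orb q))"
    using assms(1) q unfolding balanced_def by (simp only:)
qed

text \<open>Without \<open>NaC\<close> the bounds of \<open>consistent\<close> hold for every value,
  so one multiset of colours is contained in the other; both have the size of the cluster, hence
  they coincide.\<close>

lemma balanced_if_consistent:
  assumes "consistent f" "legal f"
  shows "balanced f"
  unfolding balanced_def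
proof (intro allI impI)
  fix q :: "'a point" assume q: "is_cell q"
  let ?A = "image_mset f (mset_set (orb q))" and ?B = "image_mset f_solved (mset_set (orb q))"
  have count: "count (image_mset k (mset_set (orb q))) v = card {c \<in> orb q. k c = v}" for k :: "'a conf" and v
    by (simp add: count_image_mset' Collect_conj_eq Int_commute vimage_def)
       (simp add: conj_commute eq_commute)
  have "f c \<noteq> NaC" if "c \<in> orb q" for c
    using that q is_cell_orb assms(2) unfolding legal_def by blast
  then have "count ?A NaC = 0" by (auto simp: count)
  moreover have "count ?A v \<le> count ?B v" if "v \<noteq> NaC" for v
    using assms(1) that q unfolding consistent_def count by blast
  ultimately have "?A \<subseteq># ?B"
    by (intro mset_subset_eqI) (metis le0)
  then show "?A = ?B"
    using mset_subset_size[of ?A ?B] by (auto simp: subset_mset.le_less)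
qed

section \<open>Coordinates ordered by an index\<close>

locale enumerated =
  fixes enum :: "'l \<Rightarrow> nat"
  assumes bij_enum: "bij enum"
begin

text \<open>Opposite coordinates share an index, so levels are symmetric, and among finite
  coordinates \<open>Zero\<close> alone has index 0. The value at the infinities is a default,
  guarded by \<open>is_inf\<close> wherever indices are compared.\<close>

fun idx :: "'l coord \<Rightarrow> nat" where
  "idx (Pos l) = Suc (enum l)"
| "idx (Neg l) = Suc (enum l)"
| "idx _ = 0"

lemma idx_neg [simp]: "idx (neg \<alpha>) = idx \<alpha>"
  by (cases \<alpha>) auto

lemma idx_eq: "\<not> is_inf \<alpha> \<Longrightarrow> \<not> is_inf \<beta> \<Longrightarrow> idx \<alpha> = idx \<beta> \<Longrightarrow> \<alpha> = \<beta> \<or> \<alpha> = neg \<beta>"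
  using bij_enum by (cases \<alpha>; cases \<beta>) (auto simp: bij_def inj_eq)

definition level :: "nat \<Rightarrow> 'l coord set" where
  "level k = {\<alpha>. is_inf \<alpha> \<or> k \<le> idx \<alpha>}"

lemma level_mono: "k \<le> k' \<Longrightarrow> level k' \<subseteq> level k"
  by (auto simp: level_def)

text \<open>\<open>below k\<close> describes the cells solved once the first \<open>k\<close> levels
  are done. The stronger \<open>all_below k\<close> singles out those whose colour no later turn
  disturbs even temporarily.\<close>

fun below :: "nat \<Rightarrow> 'l point \<Rightarrow> bool" where
  "below k (x, y, z) \<longleftrightarrow> (\<exists>\<alpha>\<in>{x, y, z}. \<not> is_inf \<alpha> \<and> idx \<alpha> < k)"

fun all_below :: "nat \<Rightarrow> 'l point \<Rightarrow> bool" where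
  "all_below k (x, y, z) \<longleftrightarrow> (\<forall>\<alpha>\<in>{x, y, z}. is_inf \<alpha> \<or> idx \<alpha> < k)"

lemma below_rot: "below k (rot i p) = below k p"
  by (cases i; cases p) auto

lemma below_orb: "p \<in> orb q \<Longrightarrow> below k p = below k q"
proof -
  have "\<rho> \<in> rots \<Longrightarrow> below k (\<rho> q) = below k q" for \<rho>
    by (induction arbitrary: q rule: rots.induct) (simp_all only: id_apply o_apply below_rot)
  then show "p \<in> orb q \<Longrightarrow> below k p = below k q" by (auto simp: orb_def)
qed

text \<open>The centres appear separately: the rotations do not act freely on them, so they fit no
  \<open>orbit_family\<close> and are settled before level 0.\<close>

definition solved_to :: "nat \<Rightarrow> 'l conf \<Rightarrow> bool" where
  "solved_to k h \<longleftrightarrow> balanced h \<and> (\<forall>c\<in>centres. h c = f_solved c) \<and>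
     (\<forall>c. is_cell c \<longrightarrow> below k c \<longrightarrow> h c = f_solved c)"

definition axis_coord :: "nat \<Rightarrow> 'l coord" where
  "axis_coord k = (case k of 0 \<Rightarrow> Zero | Suc j \<Rightarrow> Pos (inv enum j))"

text \<open>With \<open>Zero\<close> in first place a half turn of the face changes the sign of the
  second coordinate, so positive ones suffice. Otherwise the diagonal cell
  \<open>(a, a, PInf)\<close> is represented by its rotated copy
  \<open>(a, neg a, PInf)\<close>.\<close>

definition seconds :: "nat \<Rightarrow> 'l coord set" where
  "seconds k = (case k of 0 \<Rightarrow> range Pos
     | Suc j \<Rightarrow> {s. \<not> is_inf s \<and> s \<noteq> axis_coord k \<and> k \<le> idx s})"

lemma idx_axis_coord: "idx (axis_coord k) = k" and axis_coord_finite: "\<not> is_inf (axis_coord k)"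
  using bij_enum by (auto simp: axis_coord_def bij_is_surj surj_f_inv_f split: nat.split)

lemma orbit_family_level: "orbit_family (axis_coord k) (seconds k) (level k)"
proof
  show "axis_coord k = Zero \<and> seconds k \<subseteq> range Pos \<or>
    axis_coord k \<in> range Pos \<and> (\<forall>s\<in>seconds k. \<not> is_inf s \<and> s \<noteq> Zero \<and> s \<noteq> axis_coord k)"
    by (cases k) (auto simp: axis_coord_def seconds_def)
qed (auto simp: level_def idx_axis_coord seconds_def split: nat.splits)

text \<open>On the top face a quarter turn brings a coordinate of index \<open>k\<close> to the
  front and a half turn corrects its sign; the second coordinates excluded from
  \<open>seconds\<close> are then rotated to their representatives or give a centre.\<close>

lemma cell_of_level:
  assumes c: "is_cell c" and b: "below (Suc k) c" "\<not> below k c"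
  shows "c \<in> centres \<or> (\<exists>s\<in>seconds k. c \<in> orb (axis_coord k, s, PInf))"
proof -
  obtain \<alpha> \<beta> where ab: "\<not> is_inf \<alpha>" "\<not> is_inf \<beta>" "c \<in> orb (\<alpha>, \<beta>, PInf)"
    using cell_orb_top[OF c] .
  have turn: "(\<alpha>, \<beta>, PInf) \<in> orb q" if "(neg \<beta>, \<alpha>, PInf) \<in> orb q" for \<alpha> \<beta> and q :: "'l point"
    using orb_rot[of AZ "(\<alpha>, \<beta>, PInf)"] that by simp
  have half: "(\<alpha>, \<beta>, PInf) \<in> orb q" if "(neg \<alpha>, neg \<beta>, PInf) \<in> orb q" for \<alpha> \<beta> and q :: "'l point"
    using turn that by blast
  have "below (Suc k) (\<alpha>, \<beta>, PInf)" "\<not> below k (\<alpha>, \<beta>, PInf)"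
    using b below_orb ab(3) by blast+
  then have i: "k \<le> idx \<alpha>" "k \<le> idx \<beta>" "idx \<alpha> = k \<or> idx \<beta> = k"
    using ab by auto
  obtain \<alpha>' \<beta>' where ab': "\<not> is_inf \<alpha>'" "\<not> is_inf \<beta>'" "c \<in> orb (\<alpha>', \<beta>', PInf)" "idx \<alpha>' = k" "k \<le> idx \<beta>'"
  proof (cases "idx \<alpha> = k")
    case True
    then show thesis using that ab i by blast
  next
    case False
    then show thesis using that[of "neg \<beta>" \<alpha>] ab i turn[of \<beta> \<alpha>] orb_trans[OF ab(3)] by (auto simp: turn)
  qed
  obtain s where s: "\<not> is_inf s" "c \<in> orb (axis_coord k, s, PInf)" "k \<le> idx s"
  proof -
    consider "\<alpha>' = axis_coord k" | "\<alpha>' = neg (axis_coord k)"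
      using idx_eq ab' axis_coord_finite idx_axis_coord by metis
    then show thesis
    proof cases
      case 1
      then show thesis using that ab' by blast
    next
      case 2
      then show thesis using that[of "neg \<beta>'"] ab' orb_trans[OF ab'(3) half] by simp
    qed
  qed
  show ?thesis
  proof (cases k)
    case 0
    show ?thesis
    proof (cases s)
      case (Neg l)
      have "c \<in> orb (Zero, Pos l, PInf)"
        using orb_trans[OF s(2) half] by (simp add: 0 axis_coord_def Neg)
      then show ?thesis by (auto simp: 0 axis_coord_def seconds_def)
    qed (use s 0 in \<open>auto simp: axis_coord_def seconds_def\<close>)
  next
    case (Suc j)
    let ?a = "axis_coord k"
    show ?thesis
    proof (cases "s = ?a")
      case True
      have "c \<in> orb (?a, neg ?a, PInf)"
        using orb_trans[OF s(2) half[OF turn]] by (simp add: True)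
      moreover have "?a \<noteq> Zero" using idx_axis_coord[of k] Suc by auto
      then have "neg ?a \<in> seconds k"
        by (simp add: seconds_def Suc idx_axis_coord axis_coord_finite)
      ultimately show ?thesis by blast
    next
      case False
      then show ?thesis using s Suc by (auto simp: seconds_def)
    qed
  qed
qed

lemma solve_level:
  assumes "solved_to k h"
  shows "\<exists>m\<in>moves (level k). solved_to (Suc k) (h \<circ> inv m)"
proof -
  interpret orbit_family "axis_coord k" "seconds k" "level k"
    by (rule orbit_family_level)
  have h: "balanced h" "\<And>c. c \<in> centres \<Longrightarrow> h c = f_solved c"
    "\<And>c. is_cell c \<Longrightarrow> below k c \<Longrightarrow> h c = f_solved c"
    using assms by (auto simp: solved_to_def)
  obtain m where m: "m \<in> moves (level k)"
    and in_orb: "\<And>s p. s \<in> seconds k \<Longrightarrow> p \<in> orb (pt s) \<Longrightarrow> h (inv m p) = f_solved p"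
    and out: "\<And>p. (\<forall>s\<in>seconds k. p \<notin> orb (pt s)) \<Longrightarrow> inv m p = p"
    using solve_orbits[of h] h(1) unfolding balanced_def by blast
  \<comment> \<open>In a treated cluster the cell ends up solved anyway; elsewhere it is not
    moved.\<close>
  have "h (inv m c) = f_solved c" if "h c = f_solved c" for c
    using that in_orb out by metis
  moreover have "h (inv m c) = f_solved c" if "is_cell c" "below (Suc k) c" "\<not> below k c" for c
    using cell_of_level[OF that] in_orb h(2) calculation by blast
  ultimately have "solved_to (Suc k) (h \<circ> inv m)"
    using h m balanced_moves unfolding solved_to_def o_apply by blast
  then show ?thesis using m by blast
qed

text \<open>On centres a turn of the middle slice agrees with the rotation of the cube, so middle
  slices imitate \<open>\<rho>\<close>. Other cells may be scrambled, as \<open>below 0\<close>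
  holds for none.\<close>

lemma solve_centres:
  assumes "balanced h" and \<rho>: "\<rho> \<in> rots" and h: "\<And>c. c \<in> centres \<Longrightarrow> h c = f_solved (\<rho> c)"
  shows "\<exists>m\<in>moves (level 0). solved_to 0 (h \<circ> inv m)"
proof -
  have "\<exists>m\<in>moves (level 0). \<forall>c\<in>centres. m c = \<rho> c"
    using \<rho>
  proof (induction rule: rots.induct)
    have step: "\<exists>m\<in>moves (level 0). \<forall>c\<in>centres. m c = (\<rho> \<circ> rot i) c"
      if "\<exists>m\<in>moves (level 0). \<forall>c\<in>centres. m c = \<rho> c" for \<rho> i
    proof -
      from that obtain m where m: "m \<in> moves (level 0)" "\<And>c. c \<in> centres \<Longrightarrow> m c = \<rho> c" by blast
      let ?s = "slice i (\<lambda>\<alpha>. if \<alpha> = Zero then 1 else 0)"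
      have "(m \<circ> ?s) c = (\<rho> \<circ> rot i) c" if "c \<in> centres" for c
      proof -
        have "rot i c \<in> centres" using that orb_rots rot_in_rots by blast
        then show ?thesis using m(2) slice_centre[OF that] by simp
      qed
      moreover have "m \<circ> ?s \<in> moves (level 0)"
        by (intro moves_comp m slice_in_moves) (auto simp: level_def)
      ultimately show ?thesis by blast
    qed
    {
      case (rots_X \<rho>)
      then show ?case using step by blast
    next
      case (rots_Y \<rho>)
      then show ?case using step by blast
    }
  qed (use moves_id in blast)
  then obtain m where m: "m \<in> moves (level 0)" "\<And>c. c \<in> centres \<Longrightarrow> m c = \<rho> c" by blast
  have "h (inv m c) = f_solved c" if "c \<in> centres" for c
  proof -
    have "inv m c \<in> centres" using that m moves_inv orb_moves by blast
    moreover have "m (inv m c) = c" using moves_bij[OF m(1)] by (metis bij_is_surj surj_f_inv_f)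
    ultimately show ?thesis using h m(2) by metis
  qed
  moreover have "\<not> below 0 c" for c by (cases c) auto
  ultimately have "solved_to 0 (h \<circ> inv m)"
    using balanced_moves[OF assms(1) m(1)] by (simp add: solved_to_def)
  then show ?thesis using m by blast
qed

end

section \<open>Realising slice turns by blocks of basic twists\<close>

lemma act_act: "bij \<sigma> \<Longrightarrow> bij \<tau> \<Longrightarrow> act \<sigma> (act \<tau> h) = act (\<sigma> \<circ> \<tau>) h"
  by (simp add: act_def o_inv_distrib comp_assoc)

text \<open>The component \<open>k\<close> only records which slices may be turned while the step is carried out.\<close>

definition step :: "nat \<times> axis \<times> ('l coord \<Rightarrow> nat) \<Rightarrow> 'l conf \<Rightarrow> 'l conf" where
  "step = (\<lambda>(k, i, e). act (slice i e))"

text \<open>Each letter will become one block of length omega, so infinitely many finite words are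
  strung into one sequence. Nonempty words ensure that letter \<open>j\<close> already occurs within
  the first \<open>Suc j\<close> words.\<close>

lemma fold_concat_infinite:
  assumes W: "\<And>n. W n \<noteq> []" and F: "\<And>n. F (Suc n) = fold g (W n) (F n)"
  obtains u G where "G 0 = F 0" "\<And>j. G (Suc j) = g (u j) (G j)"
    "\<And>n. \<exists>J. G J = F n \<and> (\<forall>j\<ge>J. \<exists>n'\<ge>n. u j \<in> set (W n'))"
    "\<And>j. \<exists>n. u j \<in> set (W n)"
proof -
  define PP where "PP n = concat (map W [0..<n])" for n
  define u where "u j = PP (Suc j) ! j" for j
  define G where "G j = fold g (map u [0..<j]) (F 0)" for j
  have PP_Suc: "PP (Suc n) = PP n @ W n" for n by (simp add: PP_def)
  have len: "n \<le> length (PP n)" for n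
  proof (induction n)
    case (Suc n)
    moreover have "length (W n) > 0" using W by simp
    ultimately show ?case unfolding PP_Suc length_append by linarith
  qed simp
  have PP_split: "PP n' = PP n @ concat (map W [n..<n'])" if "n \<le> n'" for n n'
    using upt_add_eq_append[of 0 n "n' - n"] that by (simp add: PP_def)
  have u: "u j = PP n ! j" if "j < length (PP n)" for j n
  proof (cases "n \<le> Suc j")
    case True
    then show ?thesis using PP_split[OF True] that by (simp add: u_def nth_append)
  next
    case False
    then have "PP n = PP (Suc j) @ concat (map W [Suc j..<n])" by (intro PP_split) simp
    then show ?thesis using len[of "Suc j"] by (simp add: u_def nth_append)
  qed
  have "G (length (PP n)) = fold g (PP n) (F 0)" for n
  proof -
    have "map u [0..<length (PP n)] = PP n" using u by (intro nth_equalityI) simp_all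
    then show ?thesis by (simp add: G_def)
  qed
  moreover have "fold g (PP n) (F 0) = F n" for n
    by (induction n) (simp_all add: PP_Suc F, simp add: PP_def)
  ultimately have GF: "G (length (PP n)) = F n" for n by simp
  have late: "\<exists>n'\<ge>n. u j \<in> set (W n')" if "length (PP n) \<le> j" for n j
  proof -
    have "n \<le> Suc j" using len[of n] that by simp
    from PP_split[OF this] have "u j = concat (map W [n..<Suc j]) ! (j - length (PP n))"
      and "j - length (PP n) < length (concat (map W [n..<Suc j]))"
      using that len[of "Suc j"] by (auto simp: u_def nth_append)
    then have "u j \<in> set (concat (map W [n..<Suc j]))" by (metis nth_mem)
    then show ?thesis by (auto simp del: upt_Suc)
  qed
  show thesis
  proof (rule that[of G u])
    show "G 0 = F 0" "G (Suc j) = g (u j) (G j)" for j by (simp_all add: G_def)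
    show "\<exists>J. G J = F n \<and> (\<forall>j\<ge>J. \<exists>n'\<ge>n. u j \<in> set (W n'))" for n
      using GF late by blast
    show "\<exists>n. u j \<in> set (W n)" for j
      using late[of 0 j] by (auto simp: PP_def)
  qed
qed

text \<open>The identity becomes a turn with exponent 0 instead of the empty word, because
  \<open>fold_concat_infinite\<close> needs nonempty words.\<close>

lemma moves_word:
  assumes "m \<in> moves D"
  shows "\<exists>w. (\<forall>(k', i, e)\<in>set w. k' = k \<and> (\<forall>\<alpha>. \<alpha> \<notin> D \<longrightarrow> e \<alpha> = 0)) \<and> w \<noteq> [] \<and>
    h \<circ> inv m = fold step w h"
  using assms
proof (induction rule: moves.induct)
  case moves_id
  show ?case
    by (rule exI[of _ "[(k, AX, \<lambda>\<alpha>. 0)]"]) (simp add: step_def act_def slice_zero)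
next
  case (moves_slice m e i)
  then obtain w where w: "\<forall>(k', i, e)\<in>set w. k' = k \<and> (\<forall>\<alpha>. \<alpha> \<notin> D \<longrightarrow> e \<alpha> = 0)"
    "h \<circ> inv m = fold step w h" by blast
  have "h \<circ> inv (slice i e \<circ> m) = act (slice i e) (h \<circ> inv m)"
    using moves_slice(1) by (simp add: act_def o_inv_distrib moves_bij comp_assoc)
  also have "\<dots> = fold step (w @ [(k, i, e)]) h"
    using w(2) by (simp add: step_def)
  finally have "h \<circ> inv (slice i e \<circ> m) = fold step (w @ [(k, i, e)]) h" .
  moreover have "\<forall>(k', i, e)\<in>set (w @ [(k, i, e)]). k' = k \<and> (\<forall>\<alpha>. \<alpha> \<notin> D \<longrightarrow> e \<alpha> = 0)"
    using w(1) moves_slice(2) by auto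
  ultimately show ?case by blast
qed

text \<open>The identity is not a basic twist, so a slice that has to stay put is turned forth and back;
  for uniformity every slice is turned twice.\<close>

definition turn :: "nat \<Rightarrow> bool \<Rightarrow> nat" where
  "turn n second = (if second then [3, 3, 1, 2] ! (n mod 4) else if n mod 4 = 1 then 2 else 1)"

lemma mod4_cases: "(n::nat) mod 4 = 0 \<or> n mod 4 = 1 \<or> n mod 4 = 2 \<or> n mod 4 = 3"
  by presburger

lemma turn_basic: "turn n b \<in> {1, 2, 3}"
  using mod4_cases[of n] by (auto simp: turn_def)

lemma turn_sum: "(turn n False + turn n True) mod 4 = n mod 4"
  using mod4_cases[of n] by (auto simp: turn_def)

text \<open>Slice \<open>d j\<close> is turned at positions \<open>2 * j\<close> and
  \<open>2 * j + 1\<close>; the parity of the position selects the first or second turn.\<close>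

definition block_exp :: "(nat \<Rightarrow> 'l coord) \<Rightarrow> ('l coord \<Rightarrow> nat) \<Rightarrow> nat \<Rightarrow> nat" where
  "block_exp d e n = turn (e (d (n div 2))) (odd n)"

definition block :: "(nat \<Rightarrow> 'l coord) \<Rightarrow> axis \<Rightarrow> ('l coord \<Rightarrow> nat) \<Rightarrow> nat \<Rightarrow> 'l twist" where
  "block d i e n = quarter i (d (n div 2)) ^^ block_exp d e n"

primrec block_conf :: "(nat \<Rightarrow> 'l coord) \<Rightarrow> axis \<Rightarrow> ('l coord \<Rightarrow> nat) \<Rightarrow> 'l conf \<Rightarrow> nat \<Rightarrow> 'l conf" where
  "block_conf d i e h 0 = h"
| "block_conf d i e h (Suc n) = act (block d i e n) (block_conf d i e h n)"

lemma block_basic: "block d i e n \<in> basic_twists"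
  using turn_basic unfolding block_def block_exp_def basic_twists_def by blast

lemma block_slice:
  "block d i e n = slice i (\<lambda>\<alpha>. if \<alpha> = d (n div 2) then block_exp d e n else 0)"
  by (simp add: block_def quarter_pow)

text \<open>Turns about one axis merge by adding exponents, so every initial part of a block acts as
  a single simultaneous turn.\<close>

lemma block_conf_eq:
  "block_conf d i e h n = act (slice i (\<lambda>\<alpha>. \<Sum>t<n. if \<alpha> = d (t div 2) then block_exp d e t else 0)) h"
proof (induction n)
  case 0
  show ?case by (simp add: slice_zero act_def)
next
  case (Suc n)
  then show ?case by (simp add: block_slice act_act slice_comp add.commute)
qed

lemma block_exp_total:
  assumes inj: "inj d" and n: "2 * j + 2 \<le> n"
  shows "(\<Sum>t<n. if d j = d (t div 2) then block_exp d e t else 0) mod 4 = e (d j) mod 4"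
proof -
  have "(\<Sum>t<n. if d j = d (t div 2) then block_exp d e t else 0)
      = (\<Sum>t\<in>{2 * j, 2 * j + 1}. block_exp d e t)"
  proof (rule sum.mono_neutral_cong_right)
    show "\<forall>t\<in>{..<n} - {2 * j, 2 * j + 1}. (if d j = d (t div 2) then block_exp d e t else 0) = 0"
      using inj by (auto simp: inj_eq)
  qed (use n in auto)
  then show ?thesis using turn_sum[of "e (d j)"] by (simp add: block_exp_def)
qed

text \<open>A point feels only the slice of its own \<open>i\<close>-coordinate, whose last turn
  occurs at a finite position. So every colour settles, although infinitely many slices
  turn.\<close>

lemma block_conf_limit:
  assumes "inj d" and supp: "\<And>\<alpha>. \<alpha> \<notin> range d \<Longrightarrow> e \<alpha> = 0"
  shows "\<exists>M. \<forall>n\<ge>M. block_conf d i e h n p = act (slice i e) h p"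
proof -
  let ?E = "\<lambda>n \<alpha>. \<Sum>t<n. if \<alpha> = d (t div 2) then block_exp d e t else 0"
  have "\<exists>M. \<forall>n\<ge>M. ?E n (prj i p) mod 4 = e (prj i p) mod 4"
  proof (cases "prj i p \<in> range d")
    case True
    then obtain j where "prj i p = d j" by blast
    then show ?thesis using block_exp_total[OF assms(1), of j _ e] by (intro exI[of _ "2 * j + 2"]) simp
  next
    case False
    then have "?E n (prj i p) = 0" for n by (intro sum.neutral) auto
    then show ?thesis using supp[OF False] by simp
  qed
  then obtain M where M: "\<And>n. n \<ge> M \<Longrightarrow> ?E n (prj i p) mod 4 = e (prj i p) mod 4" by blast
  have "block_conf d i e h n p = act (slice i e) h p" if "n \<ge> M" for n
  proof -
    have "(3 * ?E n (prj i p)) mod 4 = (3 * e (prj i p)) mod 4"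
      using M[OF that] by (metis mod_mult_right_eq)
    then have "(rot i ^^ (3 * ?E n (prj i p))) p = (rot i ^^ (3 * e (prj i p))) p"
      using rot_pow_mod4[of "3 * ?E n (prj i p)" i p] rot_pow_mod4[of "3 * e (prj i p)" i p] by (simp only:)
    then show ?thesis
      unfolding block_conf_eq act_slice slice_def by (simp only:)
  qed
  then show ?thesis by blast
qed

lemma f_solved_rot: "is_cell c \<Longrightarrow> is_inf (prj i c) \<Longrightarrow> f_solved (rot i c) = f_solved c"
proof -
  have face:
    "\<not> is_inf y \<Longrightarrow> \<not> is_inf z \<Longrightarrow> f_solved (x, y, z) = (if x = PInf then Red else if x = NInf then Orange else NaC)"
    "\<not> is_inf x \<Longrightarrow> \<not> is_inf z \<Longrightarrow> f_solved (x, y, z) = (if y = PInf then Blue else if y = NInf then Green else NaC)"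
    "\<not> is_inf x \<Longrightarrow> \<not> is_inf y \<Longrightarrow> f_solved (x, y, z) = (if z = PInf then White else if z = NInf then Yellow else NaC)"
    for x y z :: "'a coord"
    by (cases x; cases y; cases z; simp add: f_solved_def)+
  assume "is_cell c" "is_inf (prj i c)"
  then show ?thesis
    by (cases i; cases c) (auto simp: is_cell_def face)
qed

section \<open>Cells protected from later turns\<close>

context enumerated
begin

definition solved_inner :: "nat \<Rightarrow> 'l conf \<Rightarrow> bool" where
  "solved_inner k h \<longleftrightarrow> (\<forall>c. is_cell c \<longrightarrow> all_below k c \<longrightarrow> h c = f_solved c)"

lemma all_below_rot: "all_below k (rot i c) = all_below k c"
  by (cases c; cases i) auto

text \<open>If the \<open>i\<close>-coordinate of the cell is infinite, a face turn exchanges it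
  with equally protected cells of the same solved colour. Otherwise its index is below
  \<open>k\<close> and its slice has exponent 0.\<close>

lemma solved_inner_slice:
  assumes h: "solved_inner k h" and e: "\<And>\<alpha>. \<alpha> \<notin> level k \<Longrightarrow> e \<alpha> = 0"
  shows "solved_inner k (act (slice i e) h)"
  unfolding solved_inner_def
proof (intro allI impI)
  fix c :: "'l point" assume c: "is_cell c" "all_below k c"
  show "act (slice i e) h c = f_solved c"
  proof (cases "is_inf (prj i c)")
    case True
    have "is_cell ((rot i ^^ n) c) \<and> all_below k ((rot i ^^ n) c) \<and> f_solved ((rot i ^^ n) c) = f_solved c" for n
      using c True by (induction n) (simp_all add: is_cell_rots[OF rot_in_rots] all_below_rot f_solved_rot)
    then show ?thesis using h by (simp only: act_slice slice_def solved_inner_def)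
  next
    case False
    then have "idx (prj i c) < k" using c(2) by (cases c; cases i) auto
    then have "e (prj i c) = 0" using False by (intro e) (auto simp: level_def)
    then show ?thesis using h c unfolding act_slice slice_def solved_inner_def
      by (simp only: mult_0_right funpow.simps id_apply)
  qed
qed

lemma solved_to_inner:
  assumes "solved_to k h"
  shows "solved_inner k h"
  unfolding solved_inner_def
proof (intro allI impI)
  fix c :: "'l point" assume c: "is_cell c" "all_below k c"
  then have "below k c" by (cases c) (auto simp: is_cell_def)
  then show "h c = f_solved c" using assms c unfolding solved_to_def by blast
qed

text \<open>Each level is countable and infinite, so a simultaneous turn can be spread over a block
  of length exactly omega.\<close>

lemma level_enumeration:
  obtains d :: "nat \<Rightarrow> 'l coord" where "inj d" "range d = level k"
proof -
  have c: "countable (UNIV :: 'l set)"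
    using bij_enum countable_image_inj_on[of enum UNIV] by (auto simp: bij_def)
  have "(UNIV :: 'l coord set) = range Pos \<union> range Neg \<union> {Zero, PInf, NInf}"
  proof -
    have "\<alpha> \<in> range Pos \<union> range Neg \<union> {Zero, PInf, NInf}" for \<alpha> :: "'l coord" by (cases \<alpha>) auto
    then show ?thesis by blast
  qed
  moreover have "countable (range Pos \<union> range Neg \<union> {Zero, PInf, NInf} :: 'l coord set)"
    using c by (intro countable_Un countable_image) (auto intro: uncountable_infinite)
  ultimately have "countable (level k)"
    by (metis countable_subset subset_UNIV)
  moreover have "infinite (level k)"
  proof
    assume "finite (level k)"
    moreover have "(\<lambda>n. Pos (inv enum (k + n))) ` UNIV \<subseteq> level k"
      using bij_enum by (auto simp: level_def bij_is_surj surj_f_inv_f)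
    moreover have "inj (\<lambda>n. Pos (inv enum (k + n)) :: 'l coord)"
      using bij_enum by (intro injI) (metis add_left_cancel bij_is_surj coord.inject(1) surj_f_inv_f)
    ultimately show False using finite_subset finite_imageD infinite_UNIV_nat by blast
  qed
  ultimately have "bij_betw (from_nat_into (level k)) UNIV (level k)"
    by (rule bij_betw_from_nat_into)
  then show thesis using that[of "from_nat_into (level k)"] unfolding bij_betw_def by blast
qed

lemma solving_sequence:
  assumes "consistent f" "legal f"
  obtains u G where "G 0 = f" "\<And>j. G (Suc j) = step (u j) (G j)"
    "\<And>j k i e \<alpha>. u j = (k, i, e) \<Longrightarrow> \<alpha> \<notin> level k \<Longrightarrow> e \<alpha> = 0"
    "\<And>K. \<exists>J. solved_inner K (G J) \<and> (\<forall>j\<ge>J. K \<le> fst (u j))"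
proof -
  \<comment> \<open>Stage 0 repairs the centres and stage \<open>Suc k\<close> solves level
    \<open>k\<close>; by truncated subtraction stages 0 and 1 both use \<open>level 0\<close>. Hence
    the state reached at stage \<open>Suc K\<close> is the one solved up to
    \<open>K\<close>.\<close>
  define good where "good n w \<longleftrightarrow> w \<noteq> [] \<and>
    (\<forall>(k, i :: axis, e)\<in>set w. k = n - 1 \<and> (\<forall>\<alpha>. \<alpha> \<notin> level (n - 1) \<longrightarrow> e \<alpha> = (0::nat)))" for n w
  let ?P = "\<lambda>n h. case n of 0 \<Rightarrow> h = f | Suc k \<Rightarrow> solved_to k h"
  have "\<exists>F. \<forall>n. ?P n (F n) \<and> (\<exists>w. good n w \<and> F (Suc n) = fold step w (F n))"
  proof (rule dependent_nat_choice)
    show "\<exists>h. ?P 0 h" by simp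
    fix h n assume P: "?P n h"
    have "\<exists>m\<in>moves (level (n - 1)). ?P (Suc n) (h \<circ> inv m)"
    proof (cases n)
      case 0
      obtain \<rho> where "\<rho> \<in> rots" "\<forall>c\<in>centres. f c = NaC \<or> f c = f_solved (\<rho> c)"
        using assms(1) unfolding consistent_def by blast
      moreover have "f c \<noteq> NaC" if "c \<in> centres" for c
        using is_cell_orb[OF that] is_cell_centre assms(2) unfolding legal_def by blast
      ultimately show ?thesis
        using solve_centres[OF balanced_if_consistent[OF assms]] 0 P by auto
    next
      case (Suc k)
      then show ?thesis using solve_level P by simp
    qed
    then obtain m where m: "m \<in> moves (level (n - 1))" "?P (Suc n) (h \<circ> inv m)" by blast
    from moves_word[OF m(1), of "n - 1" h] obtain w where
      "good n w" "h \<circ> inv m = fold step w h" unfolding good_def by blast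
    then show "\<exists>h'. ?P (Suc n) h' \<and> (\<exists>w. good n w \<and> h' = fold step w h)"
      using m(2) by blast
  qed
  then obtain F where F: "\<And>n. ?P n (F n)" "\<And>n. \<exists>w. good n w \<and> F (Suc n) = fold step w (F n)" by blast
  then obtain W where W: "\<And>n. good n (W n)" "\<And>n. F (Suc n) = fold step (W n) (F n)" by metis
  have ne: "W n \<noteq> []" for n using W(1) unfolding good_def by blast
  obtain u G where
    G: "G 0 = F 0" "\<And>j. G (Suc j) = step (u j) (G j)"
    "\<And>n. \<exists>J. G J = F n \<and> (\<forall>j\<ge>J. \<exists>n'\<ge>n. u j \<in> set (W n'))"
    "\<And>j. \<exists>n. u j \<in> set (W n)"
    by (rule fold_concat_infinite[of W F step, OF ne W(2)]) (rule that; assumption)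
  show thesis
  proof (rule that[of G u])
    show "G 0 = f" using G(1) F(1)[of 0] by simp
    show "G (Suc j) = step (u j) (G j)" for j by (rule G(2))
    show "e \<alpha> = 0" if "u j = (k, i, e)" "\<alpha> \<notin> level k" for j k i e \<alpha>
      using G(4)[of j] W(1) that unfolding good_def by fastforce
    show "\<exists>J. solved_inner K (G J) \<and> (\<forall>j\<ge>J. K \<le> fst (u j))" for K
    proof -
      obtain J where J: "G J = F (Suc K)" "\<And>j. j \<ge> J \<Longrightarrow> \<exists>n'\<ge>Suc K. u j \<in> set (W n')"
        using G(3) by blast
      have "K \<le> fst (u j)" if "j \<ge> J" for j
        using J(2)[OF that] W(1) unfolding good_def by fastforce
      moreover have "solved_inner K (G J)"
        using J(1) F(1)[of "Suc K"] solved_to_inner by simp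
      ultimately show ?thesis by blast
    qed
  qed
qed

end

section \<open>The run of length omega squared\<close>

lemma omega2_iff: "(p, q) \<in> omega2_on UNIV \<longleftrightarrow> lex_le p q"
  by (simp add: omega2_on_def)

lemma lex_le_linear: "lex_le p q \<or> lex_le q p" and lex_le_refl: "lex_le p p"
  by (auto simp: lex_le_def)

lemma Field_omega2: "Field (omega2_on UNIV) = UNIV"
  using lex_le_refl omega2_iff by (metis FieldI1 UNIV_eq_I)

lemma Well_order_omega2: "Well_order (omega2_on UNIV)"
proof -
  have "omega2_on UNIV - Id = less_than <*lex*> less_than"
    by (auto simp: omega2_on_def lex_le_def)
  then have "wf (omega2_on UNIV - Id)" by (simp add: wf_lex_prod)
  moreover have "Linear_order (omega2_on UNIV)"
    unfolding order_on_defs Field_omega2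
    by (auto simp: refl_on_def trans_def antisym_def total_on_def omega2_iff lex_le_def)
  ultimately show ?thesis by (simp add: well_order_on_def Field_omega2)
qed

text \<open>Position \<open>(m, n)\<close> is step \<open>n\<close> of block \<open>m\<close>. Each
  block converges pointwise to the effect of its simultaneous turn, which is the configuration
  \<open>G (Suc m)\<close> starting the next block, as the limit clause of \<open>run\<close>
  requires.\<close>

lemma omega_squared_run:
  fixes G :: "nat \<Rightarrow> 'l conf"
  assumes d: "\<And>m. inj (d m)" "\<And>m \<alpha>. \<alpha> \<notin> range (d m) \<Longrightarrow> e m \<alpha> = 0"
    and G: "G 0 = f" "\<And>m. G (Suc m) = act (slice (i m) (e m)) (G m)"
  defines "C \<equiv> \<lambda>(m, n). block_conf (d m) (i m) (e m) (G m) n"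
  shows "run (omega2_on UNIV) (\<lambda>(m, n). block (d m) (i m) (e m) n) f
    (\<lambda>\<beta>. case \<beta> of None \<Rightarrow> lim_conf (omega2_on UNIV) UNIV C | Some \<xi> \<Rightarrow> C \<xi>)"
  (is "run ?r ?\<sigma> f ?g")
  unfolding run_def Let_def
proof
  fix \<beta> :: "(nat \<times> nat) option"
  let ?max = "\<lambda>\<xi>. \<xi> \<in> preds ?r \<beta> \<and> (\<forall>\<zeta>\<in>preds ?r \<beta>. (\<zeta>, \<xi>) \<in> ?r)"
  let ?goal = "if preds ?r \<beta> = {} then ?g \<beta> = f
      else if \<exists>\<xi>\<in>preds ?r \<beta>. \<forall>\<zeta>\<in>preds ?r \<beta>. (\<zeta>, \<xi>) \<in> ?r
        then \<forall>\<xi>\<in>preds ?r \<beta>. (\<forall>\<zeta>\<in>preds ?r \<beta>. (\<zeta>, \<xi>) \<in> ?r) \<longrightarrow> ?g \<beta> = act (?\<sigma> \<xi>) (?g (Some \<xi>))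
      else ?g \<beta> = lim_conf ?r (preds ?r \<beta>) (\<lambda>\<xi>. ?g (Some \<xi>))"
  have successor: ?goal if max: "?max \<xi>" and g: "?g \<beta> = act (?\<sigma> \<xi>) (?g (Some \<xi>))" for \<xi>
  proof -
    \<comment> \<open>\<open>run\<close> imposes the successor equation at every greatest
      predecessor, so uniqueness reduces it to one instance.\<close>
    have unique: "\<xi>' = \<xi>" if "?max \<xi>'" for \<xi>'
    proof -
      have "lex_le \<xi> \<xi>'" "lex_le \<xi>' \<xi>" using that max by (auto simp: omega2_iff)
      then show ?thesis by (auto simp: lex_le_def prod_eq_iff)
    qed
    have "preds ?r \<beta> \<noteq> {}" "\<exists>\<xi>\<in>preds ?r \<beta>. \<forall>\<zeta>\<in>preds ?r \<beta>. (\<zeta>, \<xi>) \<in> ?r"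
      using max by blast+
    then show ?thesis
    proof (simp only: if_False if_True, intro ballI impI)
      fix \<xi>' assume "\<xi>' \<in> preds ?r \<beta>" "\<forall>\<zeta>\<in>preds ?r \<beta>. (\<zeta>, \<xi>') \<in> ?r"
      then have "\<xi>' = \<xi>" using unique by blast
      then show "?g \<beta> = act (?\<sigma> \<xi>') (?g (Some \<xi>'))" using g by (simp only:)
    qed
  qed
  have limit: ?goal if "preds ?r \<beta> \<noteq> {}" "\<And>\<xi>. \<not> ?max \<xi>"
    "?g \<beta> = lim_conf ?r (preds ?r \<beta>) C"
  proof -
    have "\<not> (\<exists>\<xi>\<in>preds ?r \<beta>. \<forall>\<zeta>\<in>preds ?r \<beta>. (\<zeta>, \<xi>) \<in> ?r)" using that(2) by blast
    then show ?thesis using that(1,3) by (simp only: if_False option.case)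
  qed
  show ?goal
  proof (cases \<beta>)
    case None
    show ?thesis
    proof (rule limit)
      show "\<not> ?max \<xi>" for \<xi>
      proof
        assume "?max \<xi>"
        then have "((fst \<xi>, Suc (snd \<xi>)), \<xi>) \<in> ?r" using None Field_omega2 by auto
        then show False by (simp add: omega2_iff lex_le_def)
      qed
    qed (simp_all add: None Field_omega2)
  next
    case (Some \<eta>)
    obtain m n where \<eta>: "\<eta> = (m, n)" by fastforce
    have preds: "preds ?r \<beta> = {\<xi>. fst \<xi> < m \<or> fst \<xi> = m \<and> snd \<xi> < n}"
      by (auto simp: Some \<eta> underS_def omega2_iff lex_le_def)
    show ?thesis
    proof (cases n)
      case (Suc n')
      show ?thesis
      proof (rule successor[of "(m, n')"])
        show "?max (m, n')" unfolding preds by (auto simp: Suc omega2_iff lex_le_def)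
      qed (simp add: Some \<eta> Suc C_def)
    next
      case n: 0
      show ?thesis
      proof (cases m)
        case 0
        then show ?thesis using preds by (simp add: n Some \<eta> C_def G)
      next
        case m: (Suc m')
        show ?thesis
        proof (rule limit)
          show "preds ?r \<beta> \<noteq> {}" unfolding preds m by auto
          show "\<not> ?max \<xi>" for \<xi>
          proof
            assume "?max \<xi>"
            moreover from this have "(fst \<xi>, Suc (snd \<xi>)) \<in> preds ?r \<beta>" unfolding preds n by simp
            ultimately have "((fst \<xi>, Suc (snd \<xi>)), \<xi>) \<in> ?r" by blast
            then show False by (simp add: omega2_iff lex_le_def)
          qed
          \<comment> \<open>All positions from \<open>(m', M)\<close> up to
            \<open>(Suc m', 0)\<close>, exclusive, lie in block \<open>m'\<close>, where the colour
            at \<open>p\<close> no longer changes.\<close>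
          have "lim_conf ?r (preds ?r \<beta>) C p = act (slice (i m') (e m')) (G m') p" for p
          proof (rule lim_conf_eq)
            obtain M where "\<And>n. n \<ge> M \<Longrightarrow>
                block_conf (d m') (i m') (e m') (G m') n p = act (slice (i m') (e m')) (G m') p"
              using block_conf_limit[of "d m'" "e m'"] d by blast
            then show "ev_const ?r (preds ?r \<beta>) C p (act (slice (i m') (e m')) (G m') p)"
              unfolding ev_const_def preds n m
              by (intro bexI[of _ "(m', M)"]) (auto simp: omega2_iff lex_le_def C_def)
          qed (simp_all add: omega2_iff lex_le_linear lex_le_refl)
          then show "?g \<beta> = lim_conf ?r (preds ?r \<beta>) C"
            by (intro ext) (simp add: Some \<eta> n m C_def G)
        qed
      qed
    qed
  qed
qed

context enumerated
begin

text \<open>A given cell is \<open>all_below K\<close> for some \<open>K\<close>. From some block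
  on, all turns use slices in \<open>level K\<close> and the cell is solved; single twists inside a
  block also turn only such slices, so the colour is constant from there on.\<close>

lemma solve_in_omega_squared:
  fixes f :: "'l conf"
  assumes "consistent f" "legal f"
  shows "\<exists>\<tau>. basic_seq (omega2_on UNIV) \<tau> \<and> terminal (omega2_on UNIV) \<tau> f f_solved"
proof -
  obtain u G where G0: "G 0 = f" and G_Suc: "\<And>j. G (Suc j) = step (u j) (G j)"
    and supp: "\<And>j k i e \<alpha>. u j = (k, i, e) \<Longrightarrow> \<alpha> \<notin> level k \<Longrightarrow> e \<alpha> = 0"
    and late: "\<And>K. \<exists>J. solved_inner K (G J) \<and> (\<forall>j\<ge>J. K \<le> fst (u j))"
    using solving_sequence[OF assms] by metis
  define k i e where "k j = fst (u j)" and "i j = fst (snd (u j))" and "e j = snd (snd (u j))" for j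
  have u: "u j = (k j, i j, e j)" for j by (simp add: k_def i_def e_def)
  have "\<forall>j. \<exists>d :: nat \<Rightarrow> 'l coord. inj d \<and> range d = level (k j)"
    using level_enumeration by metis
  then obtain d :: "nat \<Rightarrow> nat \<Rightarrow> 'l coord" where d: "\<And>j. inj (d j)" "\<And>j. range (d j) = level (k j)"
    by metis
  let ?r = "omega2_on UNIV"
  define \<tau> where "\<tau> = (\<lambda>(m, n). block (d m) (i m) (e m) n)"
  define C where "C = (\<lambda>(m, n). block_conf (d m) (i m) (e m) (G m) n)"
  have "run ?r \<tau> f (\<lambda>\<beta>. case \<beta> of None \<Rightarrow> lim_conf ?r UNIV C | Some \<xi> \<Rightarrow> C \<xi>)"
    unfolding \<tau>_def C_def
  proof (rule omega_squared_run)
    show "e m \<alpha> = 0" if "\<alpha> \<notin> range (d m)" for m \<alpha> using that supp u d by blast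
    show "G (Suc m) = act (slice (i m) (e m)) (G m)" for m using G_Suc u by (simp add: step_def)
  qed (use d G0 in auto)
  moreover have "lim_conf ?r UNIV C c = f_solved c" if c: "is_cell c" for c
  proof (rule lim_conf_eq)
    obtain x y z where "c = (x, y, z)" by (cases c)
    then have "all_below (Suc (idx x + idx y + idx z)) c" by auto
    then obtain K where K: "all_below K c" ..
    obtain J where J: "solved_inner K (G J)" "\<And>j. j \<ge> J \<Longrightarrow> K \<le> k j"
      using late k_def by metis
    have lev: "\<alpha> \<in> level K" if "\<alpha> \<in> level (k m)" "m \<ge> J" for m \<alpha>
      using that J(2) level_mono by blast
    have "solved_inner K (G m)" if "m \<ge> J" for m
      using that
    proof (induction m rule: dec_induct)
      case (step m)
      then show ?case
        unfolding G_Suc u step_def prod.case by (intro solved_inner_slice) (use supp u lev in blast)+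
    qed (rule J)
    moreover have "solved_inner K (block_conf (d m) (i m) (e m) h n)"
      if "m \<ge> J" "solved_inner K h" for m n h
    proof (induction n)
      case (Suc n)
      have "d m (n div 2) \<in> level K" using lev d that by blast
      then show ?case
        using Suc unfolding block_conf.simps block_slice by (intro solved_inner_slice) auto
    qed (use that in simp)
    ultimately have "solved_inner K (C (m, n))" if "m \<ge> J" for m n
      using that by (simp add: C_def)
    then have "C (m, n) c = f_solved c" if "m \<ge> J" for m n
      using that c K unfolding solved_inner_def by blast
    then show "ev_const ?r UNIV C c (f_solved c)"
      unfolding ev_const_def by (intro bexI[of _ "(J, 0)"]) (auto simp: omega2_iff lex_le_def)
  qed (simp_all add: omega2_iff lex_le_linear lex_le_refl)
  ultimately have "terminal ?r \<tau> f f_solved"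
    unfolding terminal_def cells_eq_def by (metis (no_types, lifting) option.case(1))
  moreover have "basic_seq ?r \<tau>"
    using Well_order_omega2 block_basic by (auto simp: basic_seq_def \<tau>_def)
  ultimately show ?thesis by blast
qed

end

theorem theorem5p7:
  fixes f :: "'l conf" and r :: "'i rel" and \<sigma> :: "'i \<Rightarrow> 'l twist"
  assumes "countable (UNIV :: 'l set)" and "infinite (UNIV :: 'l set)"
    and "legal f"
    and "basic_seq r \<sigma>" and "terminal r \<sigma> f_solved f"
  shows "\<exists>S \<tau>. down_closed S \<and> basic_seq (omega2_on S) \<tau> \<and> terminal (omega2_on S) \<tau> f f_solved"
proof -
  interpret enumerated "to_nat_on (UNIV :: 'l set)"
    using to_nat_on_infinite[OF assms(1,2)] by unfold_locales (simp add: bij_betw_def bij_def)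
  obtain g where "run r \<sigma> f_solved g" "cells_eq (g None) f"
    using assms(5) unfolding terminal_def by blast
  then have "consistent f"
    using run_consistent[OF assms(4)] consistent_cong by blast
  then obtain \<tau> where "basic_seq (omega2_on UNIV) \<tau>" "terminal (omega2_on UNIV) \<tau> f f_solved"
    using solve_in_omega_squared[OF _ assms(3)] by blast
  moreover have "down_closed UNIV" by (simp add: down_closed_def)
  ultimately show ?thesis by blast
qed

end
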